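(* There exists an infinite sequence $(\Gamma_n)_{n=1}^\infty$ of CNF formulas such that $\Gamma_n$ admits $\mathsf{RAT}^-$ proofs of size $n^{O(1)}$ but requires $\mathsf{GER}^-$ proofs of size $2^{\Omega(n)}$. Conversely, there exists an infinite sequence $(\Delta_n)_{n=1}^\infty$ of CNF formulas such that $\Delta_n$ admits $\mathsf{GER}^-$ proofs of size $n^{O(1)}$ but requires $\mathsf{RAT}^-$ proofs of size $2^{\Omega(n)}$.
   Context: A literal is a propositional variable or its negation; $\overline{p}$ is the complement of $p$. A set of literals is tautological if it contains some $x$ and $\overline{x}$. A clause is a finite nontautological set of literals (read as a disjunction); $\bot$ is the empty clause. A CNF is a finite set of clauses; $\mathrm{var}(\Gamma)$ is the set of variables occurring in $\Gamma$. "Proof" of $\Gamma$ means refutation. Resolution. If $A\cup\{x\}$ and $B\cup\{\overline{x}\}$ are clauses with $x$ a variable not occurring in $A$ or $B$, and $A\cup B$ is a clause, then $A\cup B$ is their resolvent on $x$. A weakening of a clause $A$ is any clause $A\cup B$. A resolution proof of $\Gamma$ is a sequence $\Pi=(\Gamma_1,\dots,\Gamma_N)$ of CNFs with $\Gamma_1=\Gamma$, $\bot\in\Gamma_N$, and each $\Gamma_{i+1}=\Gamma_i\cup\{C\}$, where $C$ is a resolvent of two clauses of $\Gamma_i$ or a weakening of a clause of $\Gamma_i$. Its size is $|\Pi|=N$. Unit propagation. A unit propagation proof is a resolution proof in which, in each use of the resolution rule, one of the two premises is a clause with a single literal. For a set $L$ of literals, $\Gamma\vdash_1 L$ means that $\Gamma\cup\{\{\overline{p}\}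 : p\in L\}$ has a unit propagation proof. RAT. A clause $C=\{p\}\cup C'$ (with the variable of $p$ not in $C'$) is a resolution asymmetric tautology (RAT) for $p$ with respect to $\Gamma$ if for every clause $D\in\Gamma$ of the form $\{\overline{p}\}\cup D'$ (with the variable of $p$ not in $D'$) we have $\Gamma\vdash_1 C'\cup D'$. $C$ is a RAT with respect to $\Gamma$ if it is one for some $p\in C$. A $\mathsf{RAT}$ proof of $\Gamma$ is defined like a resolution proof, except that each added clause $C$ may also be any RAT with respect to the current CNF $\Gamma_i$; its size is $N$. A $\mathsf{RAT}^-$ proof of $\Gamma$ is a $\mathsf{RAT}$ proof in which only variables of $\mathrm{var}(\Gamma)$ occur. GER. A clause $C=\{p\}\cup C'$ (variable of $p$ not in $C'$) is blocked for $p$ with respect to $\Gamma$ if for every $D\in\Gamma$ of the form $\{\overline{p}\}\cup D'$ the set $C'\cup D'$ is tautological; $C$ is blocked with respect to $\Gamma$ if it is so for some $p\in C$. The kernel $\ker(\Gamma)$ is the CNF obtained from $\Gamma$ by repeatedly removing a clause that is blocked with respect to the current set, until no clause of the current set is blocked with respect to it (the result does not depend on the order of removal). A CNF $\Lambda$ is a blocked extension for $\Gamma$ if $\ker(\Gamma\cup\Lambda)=\ker(\Gamma)$. A $\mathsf{GER}$ proof of $\Gamma$ is a pair $(\Lambda,\Pi)$ where $\Lambda$ is a blocked extension for $\Gamma$ and $\Pi$ is a resolution proof of $\Gamma\cup\Lambda$; its size is $|\Lambda|+|\Pi|$, where $|\Lambda|$ is the number of clauses. It is a $\mathsf{GER}^-$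 proof if $\mathrm{var}(\Lambda)\subseteq\mathrm{var}(\Gamma)$. *)

theory Defs
  imports Complex_Main
begin

datatype 'v lit = Pos 'v | Neg 'v

fun compl :: "'v lit \<Rightarrow> 'v lit" where
  "compl (Pos x) = Neg x"
| "compl (Neg x) = Pos x"

fun var_of :: "'v lit \<Rightarrow> 'v" where
  "var_of (Pos x) = x"
| "var_of (Neg x) = x"

type_synonym 'v clause = "'v lit set"
type_synonym 'v cnf = "'v clause set"

definition tautological :: "'v lit set \<Rightarrow> bool" where
  "tautological L \<longleftrightarrow> (\<exists>x. Pos x \<in> L \<and> Neg x \<in> L)"

definition is_clause :: "'v lit set \<Rightarrow> bool" where
  "is_clause C \<longleftrightarrow> finite C \<and> \<not> tautological C"

definition is_cnf :: "'v lit set set \<Rightarrow> bool" where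
  "is_cnf \<Gamma> \<longleftrightarrow> finite \<Gamma> \<and> (\<forall>C\<in>\<Gamma>. is_clause C)"

definition lits_vars :: "'v lit set \<Rightarrow> 'v set" where
  "lits_vars L = var_of ` L"

definition cnf_vars :: "'v cnf \<Rightarrow> 'v set" where
  "cnf_vars \<Gamma> = (\<Union>C\<in>\<Gamma>. lits_vars C)"


subsection \<open>Resolution\<close>

definition resolvent :: "'v \<Rightarrow> 'v clause \<Rightarrow> 'v clause \<Rightarrow> 'v clause \<Rightarrow> bool" where
  "resolvent x P Q R \<longleftrightarrow>
     (\<exists>A B. P = A \<union> {Pos x} \<and> Q = B \<union> {Neg x} \<and> R = A \<union> B \<and>
            is_clause P \<and> is_clause Q \<and> is_clause R \<and>
            x \<notin> lits_vars A \<and> x \<notin> lits_vars B)"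

definition weakening :: "'v clause \<Rightarrow> 'v clause \<Rightarrow> bool" where
  "weakening A C \<longleftrightarrow> is_clause A \<and> is_clause C \<and> (\<exists>B. C = A \<union> B)"

definition res_rule :: "'v cnf \<Rightarrow> 'v clause \<Rightarrow> bool" where
  "res_rule \<Gamma> C \<longleftrightarrow>
     (\<exists>P\<in>\<Gamma>. \<exists>Q\<in>\<Gamma>. \<exists>x. resolvent x P Q C) \<or> (\<exists>A\<in>\<Gamma>. weakening A C)"

definition unit_rule :: "'v cnf \<Rightarrow> 'v clause \<Rightarrow> bool" where
  "unit_rule \<Gamma> C \<longleftrightarrow>
     (\<exists>P\<in>\<Gamma>. \<exists>Q\<in>\<Gamma>. (is_singleton P \<or> is_singleton Q) \<and> (\<exists>x. resolvent x P Q C)) \<or>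
     (\<exists>A\<in>\<Gamma>. weakening A C)"

text \<open>A refutation is the list of successive CNFs, each obtained from its predecessor by adding
  one clause permitted by the rule. Its size is the length of the list.\<close>

definition refutation_by :: "('v cnf \<Rightarrow> 'v clause \<Rightarrow> bool) \<Rightarrow> 'v cnf \<Rightarrow> 'v cnf list \<Rightarrow> bool" where
  "refutation_by rule \<Gamma> \<Pi> \<longleftrightarrow>
     is_cnf \<Gamma> \<and> \<Pi> \<noteq> [] \<and> hd \<Pi> = \<Gamma> \<and> {} \<in> last \<Pi> \<and>
     (\<forall>i. Suc i < length \<Pi> \<longrightarrow> (\<exists>C. rule (\<Pi> ! i) C \<and> \<Pi> ! Suc i = \<Pi> ! i \<union> {C}))"

definition resolution_proof :: "'v cnf \<Rightarrow> 'v cnf list \<Rightarrow> bool" where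
  "resolution_proof = refutation_by res_rule"

definition unit_propagation_proof :: "'v cnf \<Rightarrow> 'v cnf list \<Rightarrow> bool" where
  "unit_propagation_proof = refutation_by unit_rule"

definition up_implies :: "'v cnf \<Rightarrow> 'v lit set \<Rightarrow> bool" (infix "\<turnstile>\<^sub>1" 50) where
  "\<Gamma> \<turnstile>\<^sub>1 L \<longleftrightarrow> (\<exists>\<Pi>. unit_propagation_proof (\<Gamma> \<union> (\<lambda>p. {compl p}) ` L) \<Pi>)"


subsection \<open>RAT\<close>

text \<open>In \<open>C' \<union> D'\<close> below, as in the definition of a blocked clause, the union may be tautological
  and is treated merely as a set of literals.\<close>

definition rat_for :: "'v lit \<Rightarrow> 'v clause \<Rightarrow> 'v cnf \<Rightarrow> bool" where
  "rat_for p C \<Gamma> \<longleftrightarrow>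
     is_clause C \<and>
     (\<exists>C'. C = {p} \<union> C' \<and> var_of p \<notin> lits_vars C' \<and>
        (\<forall>D'. {compl p} \<union> D' \<in> \<Gamma> \<and> var_of p \<notin> lits_vars D' \<longrightarrow> \<Gamma> \<turnstile>\<^sub>1 C' \<union> D'))"

definition is_rat :: "'v clause \<Rightarrow> 'v cnf \<Rightarrow> bool" where
  "is_rat C \<Gamma> \<longleftrightarrow> (\<exists>p\<in>C. rat_for p C \<Gamma>)"

definition rat_rule :: "'v cnf \<Rightarrow> 'v clause \<Rightarrow> bool" where
  "rat_rule \<Gamma> C \<longleftrightarrow> res_rule \<Gamma> C \<or> is_rat C \<Gamma>"

definition rat_proof :: "'v cnf \<Rightarrow> 'v cnf list \<Rightarrow> bool" where
  "rat_proof = refutation_by rat_rule"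

definition rat_minus_proof :: "'v cnf \<Rightarrow> 'v cnf list \<Rightarrow> bool" where
  "rat_minus_proof \<Gamma> \<Pi> \<longleftrightarrow>
     rat_proof \<Gamma> \<Pi> \<and> (\<forall>\<Delta>\<in>set \<Pi>. cnf_vars \<Delta> \<subseteq> cnf_vars \<Gamma>)"


subsection \<open>GER\<close>

definition blocked_for :: "'v lit \<Rightarrow> 'v clause \<Rightarrow> 'v cnf \<Rightarrow> bool" where
  "blocked_for p C \<Gamma> \<longleftrightarrow>
     is_clause C \<and>
     (\<exists>C'. C = {p} \<union> C' \<and> var_of p \<notin> lits_vars C' \<and>
        (\<forall>D'. {compl p} \<union> D' \<in> \<Gamma> \<and> var_of p \<notin> lits_vars D' \<longrightarrow> tautological (C' \<union> D')))"

definition blocked :: "'v clause \<Rightarrow> 'v cnf \<Rightarrow> bool" where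
  "blocked C \<Gamma> \<longleftrightarrow> (\<exists>p\<in>C. blocked_for p C \<Gamma>)"

definition remove_blocked :: "'v cnf \<Rightarrow> 'v cnf \<Rightarrow> bool" where
  "remove_blocked \<Gamma> \<Delta> \<longleftrightarrow> (\<exists>C\<in>\<Gamma>. blocked C \<Gamma> \<and> \<Delta> = \<Gamma> - {C})"

definition is_kernel :: "'v cnf \<Rightarrow> 'v cnf \<Rightarrow> bool" where
  "is_kernel \<Gamma> K \<longleftrightarrow> remove_blocked\<^sup>*\<^sup>* \<Gamma> K \<and> (\<forall>C\<in>K. \<not> blocked C K)"

definition kernel :: "'v cnf \<Rightarrow> 'v cnf" where
  "kernel \<Gamma> = (THE K. is_kernel \<Gamma> K)"

lemma blocked_antimono: "blocked C \<Gamma> \<Longrightarrow> \<Delta> \<subseteq> \<Gamma> \<Longrightarrow> blocked C \<Delta>"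
  unfolding blocked_def blocked_for_def by blast

lemma unblocked_subset_persists:
  assumes "remove_blocked\<^sup>*\<^sup>* \<Gamma> \<Delta>" and "K \<subseteq> \<Gamma>" and "\<forall>C\<in>K. \<not> blocked C K"
  shows "K \<subseteq> \<Delta>"
  using assms
proof (induction rule: rtranclp_induct)
  case (step \<Delta> \<Delta>')
  then show ?case
    unfolding remove_blocked_def using blocked_antimono by fastforce
qed

lemma remove_blocked_subset: "remove_blocked\<^sup>*\<^sup>* \<Gamma> \<Delta> \<Longrightarrow> \<Delta> \<subseteq> \<Gamma>"
  by (induction rule: rtranclp_induct) (auto simp: remove_blocked_def)

lemma is_kernel_unique: "is_kernel \<Gamma> K \<Longrightarrow> is_kernel \<Gamma> K' \<Longrightarrow> K = K'"
  unfolding is_kernel_def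
  by (meson remove_blocked_subset unblocked_subset_persists subset_antisym)

lemma is_kernel_exists:
  assumes "finite \<Gamma>" shows "\<exists>K. is_kernel \<Gamma> K"
  using assms
proof (induction rule: finite_psubset_induct)
  case (psubset \<Gamma>)
  show ?case
  proof (cases "\<exists>C\<in>\<Gamma>. blocked C \<Gamma>")
    case True
    then obtain C where C: "C \<in> \<Gamma>" "blocked C \<Gamma>" by blast
    then obtain K where "is_kernel (\<Gamma> - {C}) K" using psubset.IH[of "\<Gamma> - {C}"] by blast
    moreover have "remove_blocked \<Gamma> (\<Gamma> - {C})" using C unfolding remove_blocked_def by blast
    ultimately show ?thesis unfolding is_kernel_def by (meson converse_rtranclp_into_rtranclp)
  next
    case False
    then show ?thesis unfolding is_kernel_def by blast
  qed
qed

lemma kernel_is_kernel: "finite \<Gamma> \<Longrightarrow> is_kernel \<Gamma> (kernel \<Gamma>)"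
  unfolding kernel_def using is_kernel_exists is_kernel_unique by (metis theI)

definition blocked_extension :: "'v cnf \<Rightarrow> 'v cnf \<Rightarrow> bool" where
  "blocked_extension \<Gamma> \<Lambda> \<longleftrightarrow> is_cnf \<Lambda> \<and> kernel (\<Gamma> \<union> \<Lambda>) = kernel \<Gamma>"

definition ger_proof :: "'v cnf \<Rightarrow> 'v cnf \<times> 'v cnf list \<Rightarrow> bool" where
  "ger_proof \<Gamma> = (\<lambda>(\<Lambda>, \<Pi>). is_cnf \<Gamma> \<and> blocked_extension \<Gamma> \<Lambda> \<and> resolution_proof (\<Gamma> \<union> \<Lambda>) \<Pi>)"

definition ger_minus_proof :: "'v cnf \<Rightarrow> 'v cnf \<times> 'v cnf list \<Rightarrow> bool" where
  "ger_minus_proof \<Gamma> P \<longleftrightarrow> ger_proof \<Gamma> P \<and> cnf_vars (fst P) \<subseteq> cnf_vars \<Gamma>"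

definition ger_size :: "'v cnf \<times> 'v cnf list \<Rightarrow> nat" where
  "ger_size = (\<lambda>(\<Lambda>, \<Pi>). card \<Lambda> + length \<Pi>)"


subsection \<open>Growth rates\<close>

text \<open>Here \<open>is_proof \<Gamma> P\<close> says that \<open>P\<close> is a proof of \<open>\<Gamma>\<close>, and formula sequences are indexed from 1.
  The factor \<open>c\<close> in the first bound absorbs small \<open>n\<close> (where \<open>n ^ c\<close> would be 1 for \<open>n = 1\<close>), so that
  a proof is demanded for every \<open>n \<ge> 1\<close>.\<close>

definition admits_poly_size ::
  "('v cnf \<Rightarrow> 'p \<Rightarrow> bool) \<Rightarrow> ('p \<Rightarrow> nat) \<Rightarrow> (nat \<Rightarrow> 'v cnf) \<Rightarrow> bool" where
  "admits_poly_size is_proof psize \<Gamma> \<longleftrightarrow>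
     (\<exists>c::nat. \<forall>n\<ge>1. \<exists>P. is_proof (\<Gamma> n) P \<and> psize P \<le> c * n ^ c)"

definition requires_exp_size ::
  "('v cnf \<Rightarrow> 'p \<Rightarrow> bool) \<Rightarrow> ('p \<Rightarrow> nat) \<Rightarrow> (nat \<Rightarrow> 'v cnf) \<Rightarrow> bool" where
  "requires_exp_size is_proof psize \<Gamma> \<longleftrightarrow>
     (\<exists>\<epsilon>::real. \<epsilon> > 0 \<and>
        (\<forall>\<^sub>F n in sequentially. \<forall>P. is_proof (\<Gamma> n) P \<longrightarrow> 2 powr (\<epsilon> * real n) \<le> real (psize P)))"

end

theory Submission
  imports Defs "HOL-Library.Nat_Bijection"
begin

text \<open>Both directions start from the pigeonhole principle \<open>F\<close>, which is hard for resolution (here by the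
  restriction argument of Beame and Pitassi) but has short refutations once Cook's extension variables
  are defined; the formulas below mention these variables in advance.

  For the first direction, add to \<open>F\<close> all weakenings of its clauses by one literal. As \<open>F\<close> stays
  unsatisfiable when \<open>p\<close> is made true, no clause at all is blocked for \<open>p\<close>, so a GER proof
  without new variables is a resolution proof. A RAT check against the weakening \<open>D \<union> {compl p}\<close>, on
  the other hand, succeeds by unit propagation because \<open>D\<close> itself is present, so RAT can define the
  extension variables.

  For the second direction, add to \<open>F\<close> an equivalent twin of every variable. The twin clauses are
  blocked and vanish in the kernel, so GER can define the extension variables. A RAT
  inference on a literal \<open>p\<close> with twin \<open>b\<close>, however, has to derive \<open>b\<close> in place of \<open>p\<close> by unit propagation,
  and one more resolution turns \<open>b\<close> back into \<open>p\<close>; so RAT proofs are simulated by resolution.\<close>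

section \<open>Literals and resolution derivations\<close>

text \<open>The hard formulas also mention extension variables and twins, so the resolution bound is
  proved for an arbitrary map from variables to cells: a twin shares the cell of its partner, an
  extension variable is constantly false. Of \<open>2 * n + 1\<close> pigeons, \<open>n\<close> are
  fixed by a partial matching, which leaves \<open>m = n + 1\<close>. Some derived clause can then
  be falsified with between \<open>m / 3\<close> and \<open>2 * m / 3\<close> different pigeons left
  out, and its monotone version has at least \<open>2 * m^2 / 9\<close> cells on the remaining grid.
  This is an 18th of \<open>4 * m^2\<close>, a bound on the number of all original cells. As long as
  clauses of that size remain, some cell hits an 18th of them, so \<open>n\<close> greedy choices
  hit all of them unless there are at least \<open>(18/17)^n\<close>. This is where 17 and 18 come
  from. RAT proofs here never delete clauses, so the twin clauses stay available to the simulation.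
  Its cost per line is polynomial in the number of variables and is absorbed by giving up half of
  the exponent.\<close>

lemma compl_compl [simp]: "compl (compl p) = p"
  by (cases p) auto

lemma var_of_compl [simp]: "var_of (compl p) = var_of p"
  by (cases p) auto

lemma compl_neq [simp]: "compl p \<noteq> p" "p \<noteq> compl p"
  by (cases p; simp)+

lemma tautological_iff: "tautological L \<longleftrightarrow> (\<exists>p\<in>L. compl p \<in> L)"
proof
  show "\<exists>p\<in>L. compl p \<in> L \<Longrightarrow> tautological L"
    unfolding tautological_def by (metis compl.simps compl_compl lit.exhaust)
qed (auto simp: tautological_def intro!: bexI[of _ "Pos _"])

lemma lits_vars_iff: "v \<in> lits_vars L \<longleftrightarrow> Pos v \<in> L \<or> Neg v \<in> L"
  unfolding lits_vars_def by (metis image_iff lit.exhaust var_of.simps)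

lemma var_in_lits_vars_iff: "var_of p \<in> lits_vars L \<longleftrightarrow> p \<in> L \<or> compl p \<in> L"
  by (cases p) (auto simp: lits_vars_iff)

lemma cnf_vars_insert: "cnf_vars (insert C \<Gamma>) = lits_vars C \<union> cnf_vars \<Gamma>"
  by (auto simp: cnf_vars_def)

lemma cnf_vars_Un: "cnf_vars (\<Gamma> \<union> \<Delta>) = cnf_vars \<Gamma> \<union> cnf_vars \<Delta>"
  by (auto simp: cnf_vars_def)

lemma cnf_vars_mono: "\<Gamma> \<subseteq> \<Delta> \<Longrightarrow> cnf_vars \<Gamma> \<subseteq> cnf_vars \<Delta>"
  by (auto simp: cnf_vars_def)

lemma is_cnf_insert: "is_cnf (insert C \<Gamma>) \<longleftrightarrow> is_clause C \<and> is_cnf \<Gamma>"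
  by (auto simp: is_cnf_def)

lemma is_cnf_Un: "is_cnf (\<Gamma> \<union> \<Delta>) \<longleftrightarrow> is_cnf \<Gamma> \<and> is_cnf \<Delta>"
  by (auto simp: is_cnf_def)

lemma is_clause_subset: "is_clause C \<Longrightarrow> D \<subseteq> C \<Longrightarrow> is_clause D"
  unfolding is_clause_def tautological_def by (meson finite_subset subsetD)

lemma is_clause_insert:
  "is_clause (insert p C) \<longleftrightarrow> is_clause C \<and> compl p \<notin> C"
  unfolding is_clause_def tautological_iff by (metis compl_compl compl_neq(1) finite_insert insert_iff)

lemma is_clause_empty [simp]: "is_clause {}"
  by (simp add: is_clause_def tautological_def)

lemma is_clause_singleton: "is_clause {p}"
  by (simp add: is_clause_insert)

text \<open>Replaces lists of CNFs by their last member and a line count. The added clause may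
  already be present, so \<open>k\<close> counts lines and not new clauses.\<close>

inductive steps :: "('v cnf \<Rightarrow> 'v clause \<Rightarrow> bool) \<Rightarrow> 'v cnf \<Rightarrow> nat \<Rightarrow> 'v cnf \<Rightarrow> bool"
  for rule \<Gamma> where
  steps_0: "steps rule \<Gamma> 0 \<Gamma>"
| steps_Suc: "steps rule \<Gamma> k \<Delta> \<Longrightarrow> rule \<Delta> C \<Longrightarrow> steps rule \<Gamma> (Suc k) (insert C \<Delta>)"

lemma steps_subset: "steps rule \<Gamma> k \<Delta> \<Longrightarrow> \<Gamma> \<subseteq> \<Delta>"
  by (induction rule: steps.induct) auto

lemma steps_trans:
  assumes "steps rule \<Delta> l \<Theta>" and "steps rule \<Gamma> k \<Delta>"
  shows "steps rule \<Gamma> (k + l) \<Theta>"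
  using assms by (induction rule: steps.induct) (auto intro: steps.intros)

lemma steps_rule_mono:
  assumes "steps rule \<Gamma> k \<Delta>" and "\<And>\<Theta> C. rule \<Theta> C \<Longrightarrow> rule' \<Theta> C"
  shows "steps rule' \<Gamma> k \<Delta>"
  using assms by (induction rule: steps.induct) (auto intro: steps.intros)

lemma steps_of_refutation:
  assumes "refutation_by rule \<Gamma> \<Pi>"
  shows "\<exists>k. length \<Pi> = Suc k \<and> steps rule \<Gamma> k (last \<Pi>)"
proof -
  have \<Pi>: "\<Pi> \<noteq> []" "hd \<Pi> = \<Gamma>"
    and step: "\<And>i. Suc i < length \<Pi> \<Longrightarrow> \<exists>C. rule (\<Pi> ! i) C \<and> \<Pi> ! Suc i = \<Pi> ! i \<union> {C}"
    using assms by (auto simp: refutation_by_def)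
  have "steps rule \<Gamma> i (\<Pi> ! i)" if "i < length \<Pi>" for i
    using that
  proof (induction i)
    case 0
    then show ?case using \<Pi> by (metis hd_conv_nth steps_0)
  next
    case (Suc i)
    then show ?case using step[of i] steps_Suc[of rule \<Gamma> i "\<Pi> ! i"] by auto
  qed
  then show ?thesis using \<Pi>(1)
    by (metis Suc_pred' diff_Suc_1 last_conv_nth length_greater_0_conv lessI)
qed

text \<open>The size is \<open>Suc k\<close> because the initial CNF counts. The bound of all
  members by \<open>\<Delta>\<close> serves to check the variable condition of
  \<open>rat_minus_proof\<close>.\<close>

lemma refutation_of_steps:
  assumes "steps rule \<Gamma> k \<Delta>" and "is_cnf \<Gamma>" and "{} \<in> \<Delta>"
  shows "\<exists>\<Pi>. refutation_by rule \<Gamma> \<Pi> \<and> length \<Pi> = Suc k \<and> (\<forall>\<Theta>\<in>set \<Pi>. \<Theta> \<subseteq> \<Delta>)"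
proof -
  have "\<exists>\<Pi>. length \<Pi> = Suc k \<and> hd \<Pi> = \<Gamma> \<and> last \<Pi> = \<Delta> \<and> (\<forall>\<Theta>\<in>set \<Pi>. \<Theta> \<subseteq> \<Delta>) \<and>
     (\<forall>i. Suc i < length \<Pi> \<longrightarrow> (\<exists>C. rule (\<Pi> ! i) C \<and> \<Pi> ! Suc i = \<Pi> ! i \<union> {C}))"
    using assms(1)
  proof (induction rule: steps.induct)
    case steps_0
    then show ?case by (intro exI[of _ "[\<Gamma>]"]) auto
  next
    case (steps_Suc k \<Delta> C)
    then obtain \<Pi> where \<Pi>: "length \<Pi> = Suc k" "hd \<Pi> = \<Gamma>" "last \<Pi> = \<Delta>" "\<forall>\<Theta>\<in>set \<Pi>. \<Theta> \<subseteq> \<Delta>"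
      and step: "\<forall>i. Suc i < length \<Pi> \<longrightarrow> (\<exists>C. rule (\<Pi> ! i) C \<and> \<Pi> ! Suc i = \<Pi> ! i \<union> {C})"
      by blast
    have last: "\<Pi> ! k = \<Delta>" using \<Pi> by (metis diff_Suc_1 last_conv_nth length_0_conv nat.distinct(1))
    show ?case
    proof (intro exI[of _ "\<Pi> @ [insert C \<Delta>]"] conjI allI impI)
      fix i assume i: "Suc i < length (\<Pi> @ [insert C \<Delta>])"
      show "\<exists>C'. rule ((\<Pi> @ [insert C \<Delta>]) ! i) C' \<and>
          (\<Pi> @ [insert C \<Delta>]) ! Suc i = (\<Pi> @ [insert C \<Delta>]) ! i \<union> {C'}"
      proof (cases "i = k")
        case True
        then show ?thesis using \<Pi>(1) last steps_Suc.hyps(2) by (auto simp: nth_append)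
      next
        case False
        then have "Suc i < length \<Pi>" using i \<Pi>(1) by auto
        then show ?thesis using step by (auto simp: nth_append)
      qed
    qed (use \<Pi> in \<open>auto simp: hd_append\<close>)
  qed
  then obtain \<Pi> where "length \<Pi> = Suc k" "hd \<Pi> = \<Gamma>" "last \<Pi> = \<Delta>" "\<forall>\<Theta>\<in>set \<Pi>. \<Theta> \<subseteq> \<Delta>"
    "\<forall>i. Suc i < length \<Pi> \<longrightarrow> (\<exists>C. rule (\<Pi> ! i) C \<and> \<Pi> ! Suc i = \<Pi> ! i \<union> {C})"
    by blast
  then show ?thesis using assms(2,3) unfolding refutation_by_def by (intro exI[of _ \<Pi>]) auto
qed

text \<open>The step count is only bounded and surplus lines are forgotten, which lets derivations
  be concatenated and reused inside larger CNFs.\<close>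

definition derives :: "('v cnf \<Rightarrow> 'v clause \<Rightarrow> bool) \<Rightarrow> 'v cnf \<Rightarrow> nat \<Rightarrow> 'v cnf \<Rightarrow> bool" where
  "derives rule \<Gamma> m A \<longleftrightarrow> (\<exists>k\<le>m. \<exists>\<Delta>. steps rule \<Gamma> k \<Delta> \<and> A \<subseteq> \<Delta>)"

text \<open>Holds for the resolution rules. It fails for \<open>rat_rule\<close>, since a larger CNF
  has more clauses to check against; RAT lines are therefore handled with exact
  \<open>steps\<close>.\<close>

definition mono_rule :: "('v cnf \<Rightarrow> 'v clause \<Rightarrow> bool) \<Rightarrow> bool" where
  "mono_rule rule \<longleftrightarrow> (\<forall>\<Gamma> \<Delta> C. \<Gamma> \<subseteq> \<Delta> \<longrightarrow> rule \<Gamma> C \<longrightarrow> rule \<Delta> C)"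

lemma steps_mono:
  assumes "steps rule \<Gamma> k \<Gamma>'" and "mono_rule rule" and "\<Gamma> \<subseteq> \<Delta>"
  shows "steps rule \<Delta> k (\<Gamma>' \<union> \<Delta>)"
  using assms
proof (induction rule: steps.induct)
  case steps_0
  then show ?case by (metis Un_absorb1 steps.steps_0)
next
  case (steps_Suc k \<Gamma>' C)
  then have "rule (\<Gamma>' \<union> \<Delta>) C" unfolding mono_rule_def by (meson sup_ge1)
  then show ?case using steps.steps_Suc steps_Suc by fastforce
qed

lemma derives_mono:
  assumes "mono_rule rule" and "derives rule \<Gamma> m A" and "\<Gamma> \<subseteq> \<Delta>" and "m \<le> m'"
  shows "derives rule \<Delta> m' A"
  using assms steps_mono unfolding derives_def by (meson le_supI1 le_trans)

lemma derives_subset: "A \<subseteq> \<Gamma> \<Longrightarrow> derives rule \<Gamma> m A"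
  unfolding derives_def by (meson steps_0 zero_le)

lemma derives_step: "rule \<Gamma> C \<Longrightarrow> derives rule \<Gamma> 1 {C}"
  unfolding derives_def using steps_Suc[OF steps_0] by fastforce

lemma derives_trans:
  assumes "mono_rule rule" and "derives rule \<Gamma> m A" and "derives rule (\<Gamma> \<union> A) l B"
  shows "derives rule \<Gamma> (m + l) (A \<union> B)"
proof -
  obtain k \<Delta> where \<Delta>: "k \<le> m" "steps rule \<Gamma> k \<Delta>" "A \<subseteq> \<Delta>"
    using assms(2) unfolding derives_def by blast
  then have "derives rule \<Delta> l B"
    using derives_mono[OF assms(1,3)] steps_subset[OF \<Delta>(2)] by auto
  then obtain j \<Theta> where \<Theta>: "j \<le> l" "steps rule \<Delta> j \<Theta>" "B \<subseteq> \<Theta>"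
    unfolding derives_def by blast
  then have "steps rule \<Gamma> (k + j) \<Theta>" using steps_trans \<Delta>(2) by blast
  then show ?thesis unfolding derives_def
    using \<Delta>(1,3) \<Theta>(1,3) steps_subset[OF \<Theta>(2)] by (meson add_le_mono le_sup_iff subset_trans)
qed

lemma derives_weaken: "derives rule \<Gamma> m A \<Longrightarrow> B \<subseteq> A \<Longrightarrow> m \<le> m' \<Longrightarrow> derives rule \<Gamma> m' B"
  unfolding derives_def by (meson dual_order.trans)

lemma derives_union:
  assumes "mono_rule rule" and "derives rule \<Gamma> m A" and "derives rule \<Gamma> l B"
  shows "derives rule \<Gamma> (m + l) (A \<union> B)"
  using derives_trans[OF assms(1,2)] derives_mono[OF assms(1,3)] by blast

lemma derives_finite:
  assumes "mono_rule rule" and "finite A" and "\<And>C. C \<in> A \<Longrightarrow> derives rule \<Gamma> m {C}"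
  shows "derives rule \<Gamma> (card A * m) A"
  using assms(2,3)
proof (induction A)
  case empty
  then show ?case by (simp add: derives_subset)
next
  case (insert C A)
  then have "derives rule \<Gamma> (m + card A * m) ({C} \<union> A)"
    by (intro derives_union[OF assms(1)]) auto
  then show ?case using insert by simp
qed

lemma derives_cut:
  assumes "mono_rule rule" and "derives rule \<Gamma> m A" and "rule (\<Gamma> \<union> A) C"
  shows "derives rule \<Gamma> (Suc m) (insert C A)"
  using derives_trans[OF assms(1,2) derives_step[of rule, OF assms(3)]] by simp

text \<open>Without weakening no new variable can enter, so derivations of this kind respect the
  variable condition automatically.\<close>

definition res1 :: "'v cnf \<Rightarrow> 'v clause \<Rightarrow> bool" where
  "res1 \<Gamma> C \<longleftrightarrow> (\<exists>P\<in>\<Gamma>. \<exists>Q\<in>\<Gamma>. \<exists>x. resolvent x P Q C)"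

lemma mono_res1: "mono_rule res1"
  unfolding mono_rule_def res1_def by blast

lemma mono_res_rule: "mono_rule res_rule"
  unfolding mono_rule_def res_rule_def by blast

lemma res1_res_rule: "res1 \<Gamma> C \<Longrightarrow> res_rule \<Gamma> C"
  unfolding res1_def res_rule_def by blast

lemma resolventI:
  assumes "is_clause P" "is_clause Q" "is_clause R" "Pos x \<in> P" "Neg x \<in> Q"
    "R = (P - {Pos x}) \<union> (Q - {Neg x})"
  shows "resolvent x P Q R"
  unfolding resolvent_def
proof (intro exI conjI)
  show "P = (P - {Pos x}) \<union> {Pos x}" "Q = (Q - {Neg x}) \<union> {Neg x}" using assms by auto
  show "x \<notin> lits_vars (P - {Pos x})" "x \<notin> lits_vars (Q - {Neg x})"
    using assms(1,2,4,5) by (auto simp: lits_vars_iff is_clause_def tautological_def)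
qed (use assms in auto)

lemma resolventD:
  assumes "resolvent x P Q R"
  shows "Pos x \<in> P" "Neg x \<in> Q" "P \<subseteq> insert (Pos x) R" "Q \<subseteq> insert (Neg x) R"
    "R \<subseteq> P \<union> Q" "is_clause R" "P - {Pos x} \<subseteq> R" "Q - {Neg x} \<subseteq> R"
    "R = (P - {Pos x}) \<union> (Q - {Neg x})"
  using assms unfolding resolvent_def by (auto simp: lits_vars_iff)

lemma res1I:
  assumes "P \<in> \<Gamma>" "Q \<in> \<Gamma>" "is_clause P" "is_clause Q" "is_clause R" "p \<in> P" "compl p \<in> Q"
    "R = (P - {p}) \<union> (Q - {compl p})"
  shows "res1 \<Gamma> R"
proof (cases p)
  case (Pos x)
  then show ?thesis using assms resolventI[of P Q R x] unfolding res1_def by auto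
next
  case (Neg x)
  then have "resolvent x Q P R" using assms by (intro resolventI) auto
  then show ?thesis using assms unfolding res1_def by auto
qed

lemma steps_res1_vars: "steps res1 \<Gamma> k \<Delta> \<Longrightarrow> cnf_vars \<Delta> \<subseteq> cnf_vars \<Gamma>"
proof (induction rule: steps.induct)
  case (steps_Suc k \<Delta> C)
  then obtain P Q x where "P \<in> \<Delta>" "Q \<in> \<Delta>" "resolvent x P Q C" unfolding res1_def by blast
  then have "lits_vars C \<subseteq> cnf_vars \<Delta>"
    using resolventD(5)[of x P Q C] unfolding cnf_vars_def lits_vars_def by blast
  then show ?case using steps_Suc by (auto simp: cnf_vars_insert)
qed simp

section \<open>Unit propagation\<close>

lemma up_implies_tautological:
  assumes "is_cnf \<Gamma>" and "finite L" and "tautological L"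
  shows "\<Gamma> \<turnstile>\<^sub>1 L"
proof -
  let ?\<Delta> = "\<Gamma> \<union> (\<lambda>p. {compl p}) ` L"
  obtain x where x: "Pos x \<in> L" "Neg x \<in> L" using assms(3) unfolding tautological_def by blast
  have "resolvent x {Pos x} {Neg x} {}" by (intro resolventI) (auto simp: is_clause_singleton)
  moreover have "{Pos x} \<in> ?\<Delta>" "{Neg x} \<in> ?\<Delta>" using x by (force simp: image_iff)+
  ultimately have "unit_rule ?\<Delta> {}" unfolding unit_rule_def by (metis is_singletonI)
  then have "steps unit_rule ?\<Delta> 1 (insert {} ?\<Delta>)"
    using steps_Suc[OF steps_0] by fastforce
  moreover have "is_cnf ?\<Delta>" using assms by (auto simp: is_cnf_def is_clause_singleton)
  ultimately show ?thesis
    unfolding up_implies_def unit_propagation_proof_def using refutation_of_steps by blast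
qed

lemma unit_steps_of_falsified:
  assumes "finite D" and "is_cnf \<Gamma>" and "D \<in> \<Gamma>" and "(\<lambda>p. {compl p}) ` D \<subseteq> \<Gamma>"
  shows "\<exists>k \<Delta>. steps unit_rule \<Gamma> k \<Delta> \<and> {} \<in> \<Delta>"
  using assms
proof (induction D arbitrary: \<Gamma>)
  case empty
  then show ?case using steps_0 by blast
next
  case (insert p D)
  have cl: "is_clause (insert p D)" using insert.prems by (auto simp: is_cnf_def)
  have u: "{compl p} \<in> \<Gamma>" using insert.prems by auto
  have "unit_rule \<Gamma> D"
  proof (cases p)
    case (Pos x)
    then have "resolvent x (insert p D) {compl p} D"
      using cl insert.hyps by (intro resolventI) (auto simp: is_clause_singleton is_clause_insert)
    then show ?thesis unfolding unit_rule_def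
      using insert.prems u by (metis is_singletonI)
  next
    case (Neg x)
    then have "resolvent x {compl p} (insert p D) D"
      using cl insert.hyps by (intro resolventI) (auto simp: is_clause_singleton is_clause_insert)
    then show ?thesis unfolding unit_rule_def
      using insert.prems u by (metis is_singletonI)
  qed
  then have s: "steps unit_rule \<Gamma> 1 (insert D \<Gamma>)" using steps_Suc[OF steps_0] by fastforce
  obtain k \<Delta> where "steps unit_rule (insert D \<Gamma>) k \<Delta>" "{} \<in> \<Delta>"
    using insert.IH[of "insert D \<Gamma>"] insert.prems cl by (auto simp: is_cnf_insert is_clause_insert)
  then show ?case using steps_trans s by blast
qed

lemma up_implies_superset:
  assumes "is_cnf \<Gamma>" and "finite L" and "D \<in> \<Gamma>" and "D \<subseteq> L"
  shows "\<Gamma> \<turnstile>\<^sub>1 L"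
proof -
  let ?\<Delta> = "\<Gamma> \<union> (\<lambda>p. {compl p}) ` L"
  have cnf: "is_cnf ?\<Delta>" using assms by (auto simp: is_cnf_def is_clause_singleton)
  have "\<exists>k \<Delta>. steps unit_rule ?\<Delta> k \<Delta> \<and> {} \<in> \<Delta>"
    using assms cnf by (intro unit_steps_of_falsified[of D]) (auto intro: finite_subset)
  then show ?thesis
    unfolding up_implies_def unit_propagation_proof_def using refutation_of_steps cnf by blast
qed

text \<open>The literals of \<open>S\<close> are regarded as false. If no clause of \<open>\<Gamma>\<close> is falsified or unit under
  \<open>S\<close>, then every clause reached by unit propagation is satisfied or has two unassigned literals.\<close>

lemma unit_propagation_closed:
  assumes "\<not> tautological S" and "L \<subseteq> S"
    and closed: "\<And>D. D \<in> \<Gamma> \<Longrightarrow> (\<exists>q\<in>D. compl q \<in> S) \<or> (\<exists>q\<in>D - S. \<exists>r\<in>D - S. q \<noteq> r)"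
  shows "\<not> \<Gamma> \<turnstile>\<^sub>1 L"
proof
  let ?inv = "\<lambda>D. (\<exists>q\<in>D. compl q \<in> S) \<or> (\<exists>q\<in>D - S. \<exists>r\<in>D - S. q \<noteq> r)"
  let ?\<Delta> = "\<Gamma> \<union> (\<lambda>p. {compl p}) ` L"
  assume "\<Gamma> \<turnstile>\<^sub>1 L"
  then obtain \<Pi> where \<Pi>: "refutation_by unit_rule ?\<Delta> \<Pi>"
    unfolding up_implies_def unit_propagation_proof_def by blast
  then obtain k where k: "steps unit_rule ?\<Delta> k (last \<Pi>)" using steps_of_refutation by blast
  \<comment> \<open>The unit literal \<open>p\<close> must be true, so the literal
    \<open>compl p\<close> cut from \<open>Q\<close> is false. It is neither the satisfying literal
    of \<open>Q\<close> nor one of its two non-false literals, and these survive in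
    \<open>R\<close>.\<close>
  have resolve: "?inv R" if "?inv {p}" and invQ: "?inv Q" and "compl p \<in> Q" "Q - {compl p} \<subseteq> R"
    for p Q R
  proof -
    have p: "compl p \<in> S" using that(1) by auto
    then have "p \<notin> S" using assms(1) by (auto simp: tautological_iff)
    then consider q where "q \<in> Q - {compl p}" "compl q \<in> S"
      | q r where "q \<in> Q - S" "r \<in> Q - S" "q \<noteq> r"
      using invQ by (metis Diff_iff compl_compl singletonD)
    then show ?thesis
    proof cases
      case 1
      then show ?thesis using that(4) by blast
    next
      case 2
      then have "q \<in> R - S" "r \<in> R - S" using p that(4) by auto
      then show ?thesis using 2 by blast
    qed
  qed
  have inv_steps: "\<forall>D\<in>\<Theta>. ?inv D" if "steps unit_rule ?\<Delta> k \<Theta>" for k \<Theta>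
    using that
  proof (induction rule: steps.induct)
    case steps_0
    then show ?case using closed assms(2) by auto
  next
    case (steps_Suc k \<Theta> C)
    from steps_Suc.hyps(2) have "?inv C"
      unfolding unit_rule_def
    proof (elim disjE bexE conjE exE)
      fix P Q x assume PQ: "P \<in> \<Theta>" "Q \<in> \<Theta>" "is_singleton P" "resolvent x P Q C"
      then have "P = {Pos x}" using resolventD(1) by (metis is_singletonE singletonD)
      moreover have "?inv {Pos x}" "?inv Q" using steps_Suc.IH PQ(1,2) calculation by blast+
      ultimately show ?thesis
        using resolve[of "Pos x" Q C] resolventD(2,8)[OF PQ(4)] by simp
    next
      fix P Q x assume PQ: "P \<in> \<Theta>" "Q \<in> \<Theta>" "is_singleton Q" "resolvent x P Q C"
      then have "Q = {Neg x}" using resolventD(2) by (metis is_singletonE singletonD)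
      moreover have "?inv {Neg x}" "?inv P" using steps_Suc.IH PQ(1,2) calculation by blast+
      ultimately show ?thesis
        using resolve[of "Neg x" P C] resolventD(1,7)[OF PQ(4)] by simp
    next
      fix A assume "A \<in> \<Theta>" "weakening A C"
      then have "?inv A" "A \<subseteq> C" using steps_Suc.IH unfolding weakening_def by auto
      then show ?thesis by (meson Diff_iff subsetD)
    qed
    then show ?case using steps_Suc.IH by simp
  qed
  have "{} \<in> last \<Pi>" using \<Pi> unfolding refutation_by_def by simp
  then show False using bspec[OF inv_steps[OF k]] by fastforce
qed

text \<open>Unit propagation is replayed backwards without the assumed units. A clause inside
  \<open>S\<close> ends the run. A clause that is unit under \<open>S\<close> with literal
  \<open>q\<close> adds \<open>compl q\<close> to \<open>S\<close>, and one resolution with that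
  clause removes \<open>compl q\<close> again from the result. If neither exists, propagation is
  stuck, against the assumption. Each round assigns a new variable of \<open>V\<close>, hence the
  bound.\<close>

lemma derives_of_up_implies:
  assumes "is_cnf \<Gamma>" and "finite V" and "cnf_vars \<Gamma> \<subseteq> V"
    and "\<Gamma> \<turnstile>\<^sub>1 L" and "L \<subseteq> S" and "is_clause S"
  shows "\<exists>C\<subseteq>S. derives res1 \<Gamma> (card (V - lits_vars S)) {C}"
  using assms(5,6)
proof (induction "card (V - lits_vars S)" arbitrary: S rule: less_induct)
  case less
  show ?case
  proof (cases "\<exists>D\<in>\<Gamma>. D \<subseteq> S")
    case True
    then show ?thesis by (meson derives_subset empty_subsetI insert_subset)
  next
    case no_conflict: False
    show ?thesis
    proof (cases "\<exists>D\<in>\<Gamma>. \<exists>q. D - S = {q} \<and> compl q \<notin> S")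
      case True
      then obtain D q where D: "D \<in> \<Gamma>" "D - S = {q}" "compl q \<notin> S" by blast
      then have qD: "q \<in> D" "q \<notin> S" "D - {q} \<subseteq> S" by auto
      have cD: "is_clause D" using D assms(1) by (auto simp: is_cnf_def)
      let ?S = "insert (compl q) S"
      have S: "L \<subseteq> ?S" "is_clause ?S" using less.prems qD by (auto simp: is_clause_insert)
      have "var_of q \<in> V" using qD D assms(3) unfolding cnf_vars_def lits_vars_def by blast
      moreover have "var_of q \<notin> lits_vars S" using qD D by (simp add: var_in_lits_vars_iff)
      moreover have "lits_vars ?S = insert (var_of q) (lits_vars S)" by (auto simp: lits_vars_def)
      ultimately have eq: "V - lits_vars ?S \<subset> V - lits_vars S" by auto
      then have less_card: "card (V - lits_vars ?S) < card (V - lits_vars S)"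
        using assms(2) by (simp add: psubset_card_mono)
      then obtain C where C: "C \<subseteq> ?S" "derives res1 \<Gamma> (card (V - lits_vars ?S)) {C}"
        using less.hyps S by blast
      show ?thesis
      proof (cases "compl q \<in> C")
        case False
        then show ?thesis using C less_card derives_weaken
          by (metis less_imp_le order_refl subset_insert)
      next
        case True
        let ?R = "(D - {q}) \<union> (C - {compl q})"
        have R: "?R \<subseteq> S" using qD C by blast
        have "res1 (\<Gamma> \<union> {C}) ?R"
        proof (rule res1I[of D _ C _ q])
          show "is_clause C" using is_clause_subset S C by blast
          show "is_clause ?R" using is_clause_subset R less.prems by blast
        qed (use D cD qD True in auto)
        then have "derives res1 \<Gamma> (Suc (card (V - lits_vars ?S))) {?R, C}"
          using derives_cut[OF mono_res1 C(2)] by blast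
        then have "derives res1 \<Gamma> (card (V - lits_vars S)) {?R}"
          by (rule derives_weaken) (use less_card in auto)
        then show ?thesis using R by blast
      qed
    next
      case False
      have "\<not> \<Gamma> \<turnstile>\<^sub>1 L"
      proof (rule unit_propagation_closed[of S])
        fix D assume D: "D \<in> \<Gamma>"
        then obtain q where q: "q \<in> D - S" using no_conflict by blast
        show "(\<exists>q\<in>D. compl q \<in> S) \<or> (\<exists>q\<in>D - S. \<exists>r\<in>D - S. q \<noteq> r)"
        proof (cases "D - S = {q}")
          case True
          then show ?thesis using False D q by blast
        next
          case False
          then show ?thesis using q by blast
        qed
      qed (use less.prems in \<open>auto simp: is_clause_def\<close>)
      then show ?thesis using assms(4) by blast
    qed
  qed
qed

section \<open>Lower bound for the pigeonhole principle\<close>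

text \<open>Double counting of the pairs of a cell of \<open>X\<close> and a set containing it: if
  each set contains at least an 18th of the cells, some cell lies in at least an 18th of the
  sets.\<close>

lemma popular_cell:
  assumes "finite X" and "X \<noteq> {}" and "card X \<le> g" and "finite \<S>"
    and "\<And>A. A \<in> \<S> \<Longrightarrow> g \<le> 18 * card (A \<inter> X)"
  shows "\<exists>x\<in>X. card \<S> \<le> 18 * card {A \<in> \<S>. x \<in> A}"
proof (rule ccontr)
  assume "\<not> ?thesis"
  then have less: "\<And>x. x \<in> X \<Longrightarrow> 18 * card {A \<in> \<S>. x \<in> A} < card \<S>" by auto
  have "(\<Sum>x\<in>X. 18 * card {A \<in> \<S>. x \<in> A}) < (\<Sum>x\<in>X. card \<S>)"
    by (rule sum_strict_mono) (use assms less in auto)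
  also have "\<dots> \<le> card \<S> * g" using assms(3) by simp
  also have "\<dots> \<le> (\<Sum>A\<in>\<S>. 18 * card (A \<inter> X))" using sum_mono[of \<S> "\<lambda>_. g"] assms(5) by simp
  also have "\<dots> = 18 * (\<Sum>A\<in>\<S>. card {x\<in>X. x \<in> A})"
    by (simp add: sum_distrib_left Int_def conj_commute)
  also have "(\<Sum>A\<in>\<S>. card {x\<in>X. x \<in> A}) = (\<Sum>x\<in>X. card {A \<in> \<S>. x \<in> A})"
    using sum.swap_restrict[of \<S> X "\<lambda>_ _. 1::nat" "\<lambda>A x. x \<in> A"] assms(1,4) by simp
  finally show False by (simp add: sum_distrib_left)
qed

text \<open>Greedy: a pigeon is placed into the most popular cell, and pigeon and hole leave the
  grid. Each round keeps at most 17/18 of the sets that are still large, so after \<open>r\<close>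
  rounds less than one remains.\<close>

lemma hitting_matching:
  assumes "finite P" "finite H" "r \<le> card P" "r \<le> card H" "card P * card H \<le> g"
    and "finite \<S>" "card \<S> * 17 ^ r < 18 ^ r"
  shows "\<exists>P'\<subseteq>P. \<exists>H'\<subseteq>H. \<exists>\<rho>. card P' = card P - r \<and> card H' = card H - r \<and>
    bij_betw \<rho> (P - P') (H - H') \<and>
    (\<forall>A\<in>\<S>. (\<exists>i\<in>P - P'. (i, \<rho> i) \<in> A) \<or> 18 * card (A \<inter> P' \<times> H') < g)"
  using assms
proof (induction r arbitrary: P H \<S>)
  case 0
  then have "\<S> = {}" by simp
  then show ?case by (intro exI[of _ P] conjI exI[of _ H]) (auto simp: bij_betw_def)
next
  case (Suc r)
  \<comment> \<open>Largeness refers to the fixed number \<open>g\<close> and not to the current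
    grid, so a set outside \<open>\<B>\<close> stays small while the grid shrinks.\<close>
  define \<B> where "\<B> = {A \<in> \<S>. g \<le> 18 * card (A \<inter> P \<times> H)}"
  have "\<exists>x\<in>P \<times> H. card \<B> \<le> 18 * card {A \<in> \<B>. x \<in> A}"
    using Suc.prems by (intro popular_cell[where g = g]) (auto simp: \<B>_def card_cartesian_product)
  then obtain i j where ij: "i \<in> P" "j \<in> H" and pop: "card \<B> \<le> 18 * card {A \<in> \<B>. (i, j) \<in> A}"
    by blast
  define \<T> where "\<T> = {A \<in> \<B>. (i, j) \<notin> A}"
  have fin: "finite \<B>" "finite \<T>" using Suc.prems(6) by (auto simp: \<B>_def \<T>_def)
  have "\<B> = {A \<in> \<B>. (i, j) \<in> A} \<union> \<T>" "{A \<in> \<B>. (i, j) \<in> A} \<inter> \<T> = {}"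
    by (auto simp: \<T>_def)
  then have "card \<B> = card {A \<in> \<B>. (i, j) \<in> A} + card \<T>"
    using fin card_Un_disjoint by (metis finite_Un)
  then have "18 * card \<T> \<le> 17 * card \<B>" using pop by simp
  also have "card \<B> \<le> card \<S>" using Suc.prems(6) by (auto simp: \<B>_def intro: card_mono)
  finally have "18 * card \<T> \<le> 17 * card \<S>" by simp
  from mult_le_mono1[OF this, of "17 ^ r"]
  have "18 * (card \<T> * 17 ^ r) \<le> card \<S> * 17 ^ Suc r" by (simp add: ac_simps)
  also note Suc.prems(7)
  finally have small: "card \<T> * 17 ^ r < 18 ^ r" by simp
  have cards: "card (P - {i}) = card P - 1" "card (H - {j}) = card H - 1"
    using ij by auto
  have le: "r \<le> card (P - {i})" "r \<le> card (H - {j})" using Suc.prems(3,4) cards by auto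
  have "card (P - {i}) * card (H - {j}) \<le> card P * card H"
    unfolding cards by (intro mult_le_mono) auto
  then have "card (P - {i}) * card (H - {j}) \<le> g" using Suc.prems(5) by linarith
  then obtain P' H' \<rho> where P': "P' \<subseteq> P - {i}" "card P' = card (P - {i}) - r"
    and H': "H' \<subseteq> H - {j}" "card H' = card (H - {j}) - r"
    and \<rho>: "bij_betw \<rho> (P - {i} - P') (H - {j} - H')"
    and hit: "\<And>A. A \<in> \<T> \<Longrightarrow> (\<exists>i'\<in>P - {i} - P'. (i', \<rho> i') \<in> A) \<or> 18 * card (A \<inter> P' \<times> H') < g"
    using Suc.IH[OF _ _ le _ fin(2) small] Suc.prems(1,2) by (metis finite_Diff)
  have eqs: "P - P' = insert i (P - {i} - P')" "H - H' = insert j (H - {j} - H')"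
    using P' H' ij by auto
  have "bij_betw (\<rho>(i := j)) (P - P') (H - H')"
  proof -
    have "bij_betw (\<rho>(i := j)) (P - {i} - P') (H - {j} - H')"
      using \<rho> bij_betw_cong[of "P - {i} - P'" "\<rho>(i := j)" \<rho>] by auto
    then show ?thesis unfolding eqs
      using notIn_Un_bij_betw[of i "P - {i} - P'" "\<rho>(i := j)" "H - {j} - H'"] by simp
  qed
  moreover have "(\<exists>i'\<in>P - P'. (i', (\<rho>(i := j)) i') \<in> A) \<or> 18 * card (A \<inter> P' \<times> H') < g"
    if A: "A \<in> \<S>" for A
  proof (cases "A \<in> \<B>")
    case False
    have "card (A \<inter> P' \<times> H') \<le> card (A \<inter> P \<times> H)"
      using P' H' Suc.prems(1,2) by (intro card_mono) auto
    then show ?thesis using False A unfolding \<B>_def by simp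
  next
    case True
    show ?thesis
    proof (cases "(i, j) \<in> A")
      case True
      then show ?thesis unfolding eqs by auto
    next
      case False
      then have "A \<in> \<T>" using True unfolding \<T>_def by simp
      from hit[OF this] show ?thesis unfolding eqs by (metis DiffE fun_upd_other insertCI singletonI)
    qed
  qed
  moreover have "P' \<subseteq> P" "H' \<subseteq> H" "card P' = card P - Suc r" "card H' = card H - Suc r"
    using P' H' cards by auto
  ultimately show ?case by blast
qed

text \<open>A critical assignment is a bijection \<open>\<sigma>\<close> from the pigeons \<open>{..N}\<close> to the holes \<open>{..<N}\<close> extended by a
  dummy hole \<open>N\<close>; the pigeon mapped to \<open>N\<close> is left out. The map \<open>f\<close> tells which pigeonhole variable
  a given propositional variable stands for; variables with \<open>snd (f v) \<ge> N\<close> are always false.\<close>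

definition crit_val :: "nat \<Rightarrow> ('v \<Rightarrow> nat \<times> nat) \<Rightarrow> (nat \<Rightarrow> nat) \<Rightarrow> 'v \<Rightarrow> bool" where
  "crit_val N f \<sigma> v \<longleftrightarrow> fst (f v) \<le> N \<and> snd (f v) < N \<and> \<sigma> (fst (f v)) = snd (f v)"

fun lit_true :: "('v \<Rightarrow> bool) \<Rightarrow> 'v lit \<Rightarrow> bool" where
  "lit_true \<alpha> (Pos x) = \<alpha> x"
| "lit_true \<alpha> (Neg x) = (\<not> \<alpha> x)"

lemma lit_true_compl [simp]: "lit_true \<alpha> (compl p) \<longleftrightarrow> \<not> lit_true \<alpha> p"
  by (cases p) auto

definition falsifies :: "('v \<Rightarrow> bool) \<Rightarrow> 'v clause \<Rightarrow> bool" where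
  "falsifies \<alpha> C \<longleftrightarrow> (\<forall>p\<in>C. \<not> lit_true \<alpha> p)"

lemma falsifies_subset: "falsifies \<alpha> C \<Longrightarrow> A \<subseteq> C \<Longrightarrow> falsifies \<alpha> A"
  unfolding falsifies_def by blast

lemma falsifies_resolvent: "resolvent x P Q R \<Longrightarrow> falsifies \<alpha> R \<Longrightarrow> falsifies \<alpha> P \<or> falsifies \<alpha> Q"
  using resolventD(3,4) unfolding falsifies_def
  by (metis insertE lit_true.simps subsetD)

text \<open>The monotone version of a clause: a negated variable of pigeon \<open>a\<close> and hole \<open>b\<close> is, on critical
  assignments with \<open>b\<close> occupied, the disjunction of the variables of all other pigeons and \<open>b\<close>.\<close>

definition monotone_cells :: "nat \<Rightarrow> ('v \<Rightarrow> nat \<times> nat) \<Rightarrow> 'v clause \<Rightarrow> (nat \<times> nat) set" where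
  "monotone_cells N f C = {(i, j). \<exists>v. Pos v \<in> C \<and> f v = (i, j) \<or>
     Neg v \<in> C \<and> snd (f v) = j \<and> fst (f v) \<le> N \<and> i \<noteq> fst (f v)}"

lemma monotone_cells_satisfies:
  assumes "inj_on \<sigma> {..N}" and "(i, \<sigma> i) \<in> monotone_cells N f C" and "i \<le> N" and "\<sigma> i < N"
  shows "\<not> falsifies (crit_val N f \<sigma>) C"
proof -
  from assms(2) obtain v where "Pos v \<in> C \<and> f v = (i, \<sigma> i) \<or>
     Neg v \<in> C \<and> snd (f v) = \<sigma> i \<and> fst (f v) \<le> N \<and> i \<noteq> fst (f v)"
    unfolding monotone_cells_def by auto
  then show ?thesis
  proof
    assume "Pos v \<in> C \<and> f v = (i, \<sigma> i)"
    then show ?thesis using assms unfolding falsifies_def crit_val_def by force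
  next
    assume v: "Neg v \<in> C \<and> snd (f v) = \<sigma> i \<and> fst (f v) \<le> N \<and> i \<noteq> fst (f v)"
    then have "\<sigma> (fst (f v)) \<noteq> \<sigma> i" using assms(1,3) by (auto dest: inj_onD)
    then have "\<not> crit_val N f \<sigma> v" using v by (simp add: crit_val_def)
    then show ?thesis using v unfolding falsifies_def by force
  qed
qed

text \<open>Giving the hole of \<open>j\<close> to the idle pigeon \<open>i\<close> makes the cell
  \<open>(i, \<sigma> j)\<close> true, \<open>(j, \<sigma> j)\<close> false, and changes nothing
  else. The literal that becomes true is thus positive on the former or negative on the latter cell,
  and either one puts \<open>(i, \<sigma> j)\<close> among the monotone cells.\<close>

lemma swap_monotone_cells:
  assumes \<sigma>: "bij_betw \<sigma> {..N} {..N}" "\<sigma> i = N" and ij: "i \<le> N" "j \<le> N" "j \<noteq> i"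
    and "falsifies (crit_val N f \<sigma>) C"
    and "\<not> falsifies (crit_val N f (\<sigma>(i := \<sigma> j, j := N))) C"
  shows "(i, \<sigma> j) \<in> monotone_cells N f C"
proof -
  let ?\<tau> = "\<sigma>(i := \<sigma> j, j := N)"
  obtain p where p: "p \<in> C" "lit_true (crit_val N f ?\<tau>) p" "\<not> lit_true (crit_val N f \<sigma>) p"
    using assms(6,7) unfolding falsifies_def by blast
  show ?thesis
  proof (cases p)
    case (Pos v)
    then have t: "crit_val N f ?\<tau> v" and s: "\<not> crit_val N f \<sigma> v" using p by auto
    then have "?\<tau> (fst (f v)) \<noteq> \<sigma> (fst (f v))" "?\<tau> (fst (f v)) \<noteq> N" unfolding crit_val_def by auto
    then have "fst (f v) = i" by (auto split: if_splits)
    then have "f v = (i, \<sigma> j)" using t ij(3) unfolding crit_val_def by (auto simp: prod_eq_iff)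
    then show ?thesis using p Pos unfolding monotone_cells_def by blast
  next
    case (Neg v)
    then have t: "\<not> crit_val N f ?\<tau> v" and s: "crit_val N f \<sigma> v" using p by auto
    then have "?\<tau> (fst (f v)) \<noteq> \<sigma> (fst (f v))" "\<sigma> (fst (f v)) \<noteq> N" unfolding crit_val_def by auto
    then have "fst (f v) = j" using \<sigma>(2) by (auto split: if_splits)
    then show ?thesis using p s Neg ij unfolding monotone_cells_def crit_val_def by auto
  qed
qed

lemma bij_betw_swap_value:
  assumes "bij_betw \<sigma> A A" and "i \<in> A" "j \<in> A" "i \<noteq> j"
  shows "bij_betw (\<sigma>(i := \<sigma> j, j := \<sigma> i)) A A"
proof -
  have "bij_betw (id(i := j, j := i)) A A"
    using assms(2-4) by (intro bij_betw_byWitness[where f' = "id(i := j, j := i)"]) auto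
  from bij_betw_trans[OF this assms(1)] have "bij_betw (\<sigma> \<circ> id(i := j, j := i)) A A" .
  moreover have "\<sigma> \<circ> id(i := j, j := i) = \<sigma>(i := \<sigma> j, j := \<sigma> i)" by auto
  ultimately show ?thesis by simp
qed

text \<open>The complexity measure of the lower bound, relative to the partial matching
  \<open>\<rho>\<close> on \<open>Q\<close>: at most one pigeon for an axiom, all free pigeons for
  the empty clause, subadditive under resolution.\<close>

definition witnesses ::
  "nat \<Rightarrow> ('v \<Rightarrow> nat \<times> nat) \<Rightarrow> nat set \<Rightarrow> (nat \<Rightarrow> nat) \<Rightarrow> 'v clause \<Rightarrow> nat set" where
  "witnesses N f Q \<rho> C = {i. i \<le> N \<and> (\<exists>\<sigma>. bij_betw \<sigma> {..N} {..N} \<and> (\<forall>a\<in>Q. \<sigma> a = \<rho> a) \<and> \<sigma> i = N \<and>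
     falsifies (crit_val N f \<sigma>) C)}"

lemma finite_witnesses [simp]: "finite (witnesses N f Q \<rho> C)"
  by (rule finite_subset[of _ "{..N}"]) (auto simp: witnesses_def)

lemma witnesses_resolvent:
  "resolvent x A B C \<Longrightarrow> witnesses N f Q \<rho> C \<subseteq> witnesses N f Q \<rho> A \<union> witnesses N f Q \<rho> B"
  unfolding witnesses_def by (auto dest: falsifies_resolvent)

lemma witnesses_weakening: "A \<subseteq> C \<Longrightarrow> witnesses N f Q \<rho> C \<subseteq> witnesses N f Q \<rho> A"
  unfolding witnesses_def by (auto dest: falsifies_subset)

text \<open>For a witness \<open>i\<close> with assignment \<open>\<sigma>\<close> and a free
  non-witness \<open>j\<close>, swapping the two must satisfy \<open>C\<close>, so
  \<open>(i, \<sigma> j)\<close> is a monotone cell. Since \<open>\<sigma>\<close> is injective,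
  each row \<open>i\<close> of \<open>W\<close> has as many cells as there are free
  non-witnesses.\<close>

lemma card_monotone_cells:
  fixes f :: "'v \<Rightarrow> nat \<times> nat" and C :: "'v clause"
  assumes P': "P' \<subseteq> {..N}" and H': "H' \<subseteq> {..<N}"
    and \<rho>: "bij_betw \<rho> ({..N} - P') ({..<N} - H')"
  defines "W \<equiv> witnesses N f ({..N} - P') \<rho> C"
  shows "W \<subseteq> P'" and "card W * (card P' - card W) \<le> card (monotone_cells N f C \<inter> P' \<times> H')"
proof -
  have fin: "finite P'" "finite H'"
    using finite_subset[OF P'] finite_subset[OF H'] by auto
  have \<rho>_less: "\<rho> a < N" if "a \<in> {..N} - P'" for a
    using \<rho> that unfolding bij_betw_def by auto
  show W: "W \<subseteq> P'"
  proof
    fix i assume "i \<in> W"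
    then obtain \<sigma> where "i \<le> N" "\<forall>a\<in>{..N} - P'. \<sigma> a = \<rho> a" "\<sigma> i = N"
      unfolding W_def witnesses_def by blast
    then show "i \<in> P'" using \<rho>_less[of i] by (metis DiffI atMost_iff less_irrefl)
  qed
  have row: "card P' - card W \<le> card {h \<in> H'. (i, h) \<in> monotone_cells N f C}" if i: "i \<in> W" for i
  proof -
    obtain \<sigma> where \<sigma>: "i \<le> N" "bij_betw \<sigma> {..N} {..N}" "\<forall>a\<in>{..N} - P'. \<sigma> a = \<rho> a" "\<sigma> i = N"
      "falsifies (crit_val N f \<sigma>) C"
      using i unfolding W_def witnesses_def by blast
    have inj: "inj_on \<sigma> {..N}" using \<sigma>(2) by (simp add: bij_betw_def)
    have "\<sigma> j \<in> H' \<and> (i, \<sigma> j) \<in> monotone_cells N f C" if j: "j \<in> P' - W" for j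
    proof -
      have j': "j \<le> N" "j \<noteq> i" "j \<in> P'" using j i P' by auto
      have "\<sigma> j \<noteq> N" using inj \<sigma>(1,4) j' by (metis atMost_iff inj_onD)
      then have less: "\<sigma> j < N" using \<sigma>(2) j' by (metis atMost_iff bij_betwE le_neq_implies_less)
      \<comment> \<open>The proper holes outside \<open>H'\<close> are already occupied by the
        pigeons that \<open>\<rho>\<close> has placed.\<close>
      have "\<sigma> j \<in> H'"
      proof (rule ccontr)
        assume "\<sigma> j \<notin> H'"
        then have "\<sigma> j \<in> \<rho> ` ({..N} - P')" using \<rho> less unfolding bij_betw_def by auto
        then obtain a where "a \<in> {..N} - P'" "\<sigma> j = \<sigma> a" using \<sigma>(3) by auto
        then show False using inj j' by (metis DiffE atMost_iff inj_onD)
      qed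
      moreover have "bij_betw (\<sigma>(i := \<sigma> j, j := N)) {..N} {..N}"
        using bij_betw_swap_value[OF \<sigma>(2), of i j] \<sigma>(1,4) j' by simp
      moreover have "\<forall>a\<in>{..N} - P'. (\<sigma>(i := \<sigma> j, j := N)) a = \<rho> a"
        using \<sigma>(3) i W j' by auto
      ultimately have "\<not> falsifies (crit_val N f (\<sigma>(i := \<sigma> j, j := N))) C"
        using j j'(1) unfolding W_def witnesses_def by force
      then show ?thesis using swap_monotone_cells[OF \<sigma>(2,4,1) j'(1,2) \<sigma>(5)] \<open>\<sigma> j \<in> H'\<close> by blast
    qed
    then have "\<sigma> ` (P' - W) \<subseteq> {h \<in> H'. (i, h) \<in> monotone_cells N f C}" by blast
    then have "card (\<sigma> ` (P' - W)) \<le> card {h \<in> H'. (i, h) \<in> monotone_cells N f C}"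
      using fin by (intro card_mono) auto
    moreover have "card (\<sigma> ` (P' - W)) = card (P' - W)"
      using inj P' by (intro card_image inj_on_subset[OF inj]) auto
    moreover have "card (P' - W) = card P' - card W"
      using W fin by (simp add: card_Diff_subset finite_subset)
    ultimately show ?thesis by simp
  qed
  have "card W * (card P' - card W) \<le> (\<Sum>i\<in>W. card {h \<in> H'. (i, h) \<in> monotone_cells N f C})"
    using sum_mono[OF row, of W] by simp
  also have "\<dots> = card (Sigma W (\<lambda>i. {h \<in> H'. (i, h) \<in> monotone_cells N f C}))"
    using fin W by (subst card_SigmaI) (auto intro: finite_subset)
  also have "\<dots> \<le> card (monotone_cells N f C \<inter> P' \<times> H')"
    using fin W by (intro card_mono) auto
  finally show "card W * (card P' - card W) \<le> card (monotone_cells N f C \<inter> P' \<times> H')" .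
qed

text \<open>The witness set of a resolvent is covered by those of its premises, so the sizes of witness sets
  cannot jump across the range from a third to two thirds of all pigeons.\<close>

lemma medium_clause:
  assumes "steps res_rule \<Gamma> k \<Delta>"
    and "\<And>C. C \<in> \<Gamma> \<Longrightarrow> 3 * card (witnesses N f Q \<rho> C) \<le> M"
  shows "(\<exists>C\<in>\<Delta> - \<Gamma>. M < 3 * card (witnesses N f Q \<rho> C) \<and> 3 * card (witnesses N f Q \<rho> C) \<le> 2 * M)
    \<or> (\<forall>C\<in>\<Delta>. 3 * card (witnesses N f Q \<rho> C) \<le> M)"
  using assms(1)
proof (induction rule: steps.induct)
  case steps_0
  then show ?case using assms(2) by blast
next
  case (steps_Suc k \<Delta> C)
  let ?w = "\<lambda>C. card (witnesses N f Q \<rho> C)"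
  from steps_Suc.IH show ?case
  proof
    assume "\<exists>C\<in>\<Delta> - \<Gamma>. M < 3 * ?w C \<and> 3 * ?w C \<le> 2 * M"
    then show ?case by auto
  next
    assume small: "\<forall>C\<in>\<Delta>. 3 * ?w C \<le> M"
    have "\<exists>A\<in>\<Delta>. \<exists>B\<in>\<Delta>. witnesses N f Q \<rho> C \<subseteq> witnesses N f Q \<rho> A \<union> witnesses N f Q \<rho> B"
      using steps_Suc.hyps(2) unfolding res_rule_def weakening_def
      by (metis Un_upper1 sup.idem witnesses_resolvent witnesses_weakening)
    then obtain A B where AB: "A \<in> \<Delta>" "B \<in> \<Delta>"
      "witnesses N f Q \<rho> C \<subseteq> witnesses N f Q \<rho> A \<union> witnesses N f Q \<rho> B" by blast
    have "?w C \<le> card (witnesses N f Q \<rho> A \<union> witnesses N f Q \<rho> B)"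
      using AB(3) by (intro card_mono) auto
    also have "\<dots> \<le> ?w A + ?w B" by (rule card_Un_le)
    finally have "3 * ?w C \<le> 2 * M" using bspec[OF small AB(1)] bspec[OF small AB(2)] by linarith
    moreover have "C \<notin> \<Gamma>" if "M < 3 * ?w C" using assms(2)[of C] that by auto
    ultimately show ?case using small by (cases "3 * ?w C \<le> M") (auto simp: not_le)
  qed
qed

lemma steps_card_diff: "steps rule \<Gamma> k \<Delta> \<Longrightarrow> finite (\<Delta> - \<Gamma>) \<and> card (\<Delta> - \<Gamma>) \<le> k"
proof (induction rule: steps.induct)
  case (steps_Suc k \<Delta> C)
  then show ?case by (cases "C \<in> \<Gamma>") (auto simp: insert_Diff_if card_insert_if)
qed simp

text \<open>Any free pigeon can be the idle one: without it, the free pigeons and free holes are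
  equally many.\<close>

lemma exists_extending_bijection:
  fixes N :: nat
  assumes P': "P' \<subseteq> {..N}" and H': "H' \<subseteq> {..<N}" and card: "card P' = Suc (card H')"
    and \<rho>: "bij_betw \<rho> ({..N} - P') ({..<N} - H')" and i: "i \<in> P'"
  shows "\<exists>\<sigma>. bij_betw \<sigma> {..N} {..N} \<and> (\<forall>a\<in>{..N} - P'. \<sigma> a = \<rho> a) \<and> \<sigma> i = N"
proof -
  have fin: "finite P'" "finite H'"
    using finite_subset[OF P'] finite_subset[OF H'] by auto
  have "card (P' - {i}) = card H'" using card i fin by simp
  then obtain g where g: "bij_betw g (P' - {i}) H'"
    using fin finite_same_card_bij by blast
  define \<sigma> where "\<sigma> = (\<lambda>a. if a \<in> P' then if a = i then N else g a else \<rho> a)"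
  have "bij_betw \<sigma> (P' - {i}) H'" using g bij_betw_cong[of "P' - {i}" \<sigma> g] by (auto simp: \<sigma>_def)
  then have "bij_betw \<sigma> (insert i (P' - {i})) (insert N H')"
    using notIn_Un_bij_betw[of i "P' - {i}" \<sigma> H'] i H' by (auto simp: \<sigma>_def)
  moreover have "bij_betw \<sigma> ({..N} - P') ({..<N} - H')"
    using \<rho> bij_betw_cong[of "{..N} - P'" \<sigma> \<rho>] by (auto simp: \<sigma>_def)
  ultimately have "bij_betw \<sigma> (insert i (P' - {i}) \<union> ({..N} - P')) (insert N H' \<union> ({..<N} - H'))"
    by (rule bij_betw_combine) (use H' in auto)
  moreover have "insert i (P' - {i}) \<union> ({..N} - P') = {..N}" using i P' by auto
  moreover have "insert N H' \<union> ({..<N} - H') = {..N}" using H' by auto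
  ultimately have "bij_betw \<sigma> {..N} {..N}" by simp
  then show ?thesis using i by (intro exI[of _ \<sigma>]) (auto simp: \<sigma>_def)
qed

text \<open>With fewer lines, a matching of \<open>n\<close> pigeons would hit every derived clause
  whose monotone version has an 18th of the cells. A clause with a medium witness set is that large,
  but a hit clause is satisfied by all critical assignments extending the matching, whereas a
  witness falsifies it. Only clauses outside \<open>\<Gamma>\<close> are counted, so the number of
  axioms does not enter.\<close>

theorem resolution_lower_bound:
  fixes f :: "'v \<Rightarrow> nat \<times> nat"
  assumes steps: "steps res_rule \<Gamma> k \<Delta>" and "{} \<in> \<Delta>" and n: "n \<ge> 2"
    and axioms: "\<And>C. C \<in> \<Gamma> \<Longrightarrow> \<exists>i. \<forall>\<sigma>. bij_betw \<sigma> {..2 * n} {..2 * n} \<longrightarrow>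
       falsifies (crit_val (2 * n) f \<sigma>) C \<longrightarrow> \<sigma> i = 2 * n \<and> i \<le> 2 * n"
  shows "18 ^ n \<le> k * 17 ^ n"
proof (rule ccontr)
  assume "\<not> ?thesis"
  then have k: "k * 17 ^ n < 18 ^ n" by simp
  let ?N = "2 * n"
  let ?cells = "monotone_cells ?N f"
  let ?\<S> = "?cells ` (\<Delta> - \<Gamma>)"
  have fin: "finite (\<Delta> - \<Gamma>)" and card: "card (\<Delta> - \<Gamma>) \<le> k" using steps_card_diff[OF steps] by auto
  have "card ?\<S> \<le> k" using card_image_le[OF fin] card order_trans by blast
  then have "card ?\<S> * 17 ^ n \<le> k * 17 ^ n" by simp
  then have "card ?\<S> * 17 ^ n < 18 ^ n" using k by linarith
  then obtain P' H' \<rho> where P': "P' \<subseteq> {..?N}" "card P' = Suc n" and H': "H' \<subseteq> {..<?N}" "card H' = n"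
    and \<rho>: "bij_betw \<rho> ({..?N} - P') ({..<?N} - H')"
    and hit: "\<And>C. C \<in> \<Delta> - \<Gamma> \<Longrightarrow>
      (\<exists>i\<in>{..?N} - P'. (i, \<rho> i) \<in> ?cells C) \<or> 18 * card (?cells C \<inter> P' \<times> H') < Suc ?N * ?N"
    using hitting_matching[of "{..?N}" "{..<?N}" n "Suc ?N * ?N" ?\<S>] fin by auto
  let ?W = "witnesses ?N f ({..?N} - P') \<rho>"
  have "3 * card (?W C) \<le> Suc n" if C: "C \<in> \<Gamma>" for C
  proof -
    obtain i where i: "\<And>\<sigma>. bij_betw \<sigma> {..?N} {..?N} \<Longrightarrow>
       falsifies (crit_val ?N f \<sigma>) C \<Longrightarrow> \<sigma> i = ?N \<and> i \<le> ?N" using axioms[OF C] by blast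
    have "?W C \<subseteq> {i}"
    proof
      fix j assume "j \<in> ?W C"
      then obtain \<sigma> where \<sigma>: "j \<le> ?N" "bij_betw \<sigma> {..?N} {..?N}" "\<sigma> j = ?N" "falsifies (crit_val ?N f \<sigma>) C"
        unfolding witnesses_def by blast
      then have "\<sigma> i = \<sigma> j" "i \<le> ?N" using i by auto
      then show "j \<in> {i}" using \<sigma>(1,2) by (metis atMost_iff bij_betw_def inj_onD singletonI)
    qed
    then have "card (?W C) \<le> card {i}" by (intro card_mono) auto
    \<comment> \<open>Here \<open>n \<ge> 2\<close> makes a single witness at most a third of
      \<open>Suc n\<close>.\<close>
    then show ?thesis using n by simp
  qed
  from medium_clause[OF steps this]
  have "(\<exists>C\<in>\<Delta> - \<Gamma>. Suc n < 3 * card (?W C) \<and> 3 * card (?W C) \<le> 2 * Suc n)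
    \<or> (\<forall>C\<in>\<Delta>. 3 * card (?W C) \<le> Suc n)" .
  moreover have "\<not> 3 * card (?W {}) \<le> Suc n"
  proof -
    have "P' \<subseteq> ?W {}"
    proof
      fix i assume i: "i \<in> P'"
      have "\<exists>\<sigma>. bij_betw \<sigma> {..?N} {..?N} \<and> (\<forall>a\<in>{..?N} - P'. \<sigma> a = \<rho> a) \<and> \<sigma> i = ?N"
        using P' H' \<rho> i by (intro exists_extending_bijection) auto
      then show "i \<in> ?W {}" using i P'(1) unfolding witnesses_def falsifies_def by auto
    qed
    then have "card P' \<le> card (?W {})" by (intro card_mono) auto
    then show ?thesis using P'(2) by simp
  qed
  ultimately obtain C where C: "C \<in> \<Delta> - \<Gamma>" "Suc n < 3 * card (?W C)" "3 * card (?W C) \<le> 2 * Suc n"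
    using \<open>{} \<in> \<Delta>\<close> by blast
  have "?W C \<noteq> {}" using C(2) by auto
  then obtain \<sigma> where \<sigma>: "bij_betw \<sigma> {..?N} {..?N}" "\<forall>a\<in>{..?N} - P'. \<sigma> a = \<rho> a"
    "falsifies (crit_val ?N f \<sigma>) C" unfolding witnesses_def by blast
  have "(i, \<rho> i) \<notin> ?cells C" if i: "i \<in> {..?N} - P'" for i
  proof -
    have "\<rho> i < ?N" using \<rho> i unfolding bij_betw_def by auto
    then show ?thesis
      using monotone_cells_satisfies[of \<sigma> ?N i f C] \<sigma> i by (auto simp: bij_betw_def)
  qed
  then have small: "18 * card (?cells C \<inter> P' \<times> H') < Suc ?N * ?N" using hit[OF C(1)] by blast
  define w where "w = card (?W C)"
  have "w * (Suc n - w) \<le> card (?cells C \<inter> P' \<times> H')"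
    using card_monotone_cells(2)[OF P'(1) H'(1) \<rho>, of f C] P'(2) unfolding w_def by simp
  then have "18 * (w * (Suc n - w)) < Suc ?N * ?N" using small by linarith
  \<comment> \<open>With \<open>m = Suc n\<close>, the product
    \<open>(3 * w - m) * (2 * m - 3 * w)\<close> is nonnegative for medium \<open>w\<close>. This
    gives \<open>2 * m^2 \<le> 9 * w * (m - w)\<close>, while the grid has at most
    \<open>4 * m^2\<close> cells.\<close>
  moreover have "Suc ?N * ?N \<le> 18 * (w * (Suc n - w))"
  proof -
    have w: "Suc n < 3 * w" "3 * w \<le> 2 * Suc n" using C unfolding w_def by auto
    then have "0 \<le> (3 * int w - int (Suc n)) * (2 * int (Suc n) - 3 * int w)"
      by (intro mult_nonneg_nonneg) auto
    then have "2 * int (Suc n) * int (Suc n) \<le> 9 * (int w * (int (Suc n) - int w))"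
      by (simp add: algebra_simps)
    moreover have "int (Suc ?N * ?N) \<le> 4 * int (Suc n) * int (Suc n)" by (simp add: algebra_simps)
    moreover have "int (w * (Suc n - w)) = int w * (int (Suc n) - int w)"
      using w by (cases "w \<le> Suc n") (auto simp: of_nat_diff)
    ultimately have "int (Suc ?N * ?N) \<le> int (18 * (w * (Suc n - w)))" by linarith
    then show ?thesis by linarith
  qed
  ultimately show False by simp
qed

section \<open>Kernels and blocked clauses\<close>

lemma blocked_forI:
  assumes "is_clause C" and "p \<in> C"
    and clash: "\<And>D. D \<in> \<Gamma> \<Longrightarrow> compl p \<in> D \<Longrightarrow> \<exists>r\<in>C. r \<noteq> p \<and> compl r \<in> D"
  shows "blocked_for p C \<Gamma>"
  unfolding blocked_for_def
proof (intro conjI exI[of _ "C - {p}"] allI impI)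
  show "C = {p} \<union> (C - {p})" using assms(2) by auto
  show "var_of p \<notin> lits_vars (C - {p})"
    using assms(1,2) unfolding var_in_lits_vars_iff is_clause_def tautological_iff by auto
  fix D' assume "{compl p} \<union> D' \<in> \<Gamma> \<and> var_of p \<notin> lits_vars D'"
  then obtain r where "r \<in> C" "r \<noteq> p" "compl r \<in> {compl p} \<union> D'" using clash by blast
  then have "r \<in> C - {p}" "compl r \<in> D'" by (auto, metis compl_compl)
  then show "tautological (C - {p} \<union> D')" unfolding tautological_iff by blast
qed (use assms in auto)

text \<open>A clause blocked in the full set stays blocked in every subset, so the clauses of
  \<open>X\<close> can be peeled off in any order; those shared with \<open>\<Gamma>\<close>
  stay.\<close>

lemma remove_blocked_Un:
  assumes "finite X" and "\<And>C. C \<in> X \<Longrightarrow> blocked C (\<Gamma> \<union> X)"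
  shows "remove_blocked\<^sup>*\<^sup>* (\<Gamma> \<union> X) \<Gamma>"
  using assms
proof (induction X)
  case (insert C X)
  have IH: "remove_blocked\<^sup>*\<^sup>* (\<Gamma> \<union> X) \<Gamma>"
    using insert.prems by (intro insert.IH) (auto intro: blocked_antimono)
  show ?case
  proof (cases "C \<in> \<Gamma>")
    case True
    then show ?thesis using IH by (simp add: insert_absorb)
  next
    case False
    have "remove_blocked (\<Gamma> \<union> insert C X) (\<Gamma> \<union> X)"
      unfolding remove_blocked_def using insert False by (intro bexI[of _ C]) auto
    then show ?thesis using IH by (rule converse_rtranclp_into_rtranclp)
  qed
qed simp

lemma kernel_eq_of_remove_blocked:
  assumes "finite \<Gamma>" and "remove_blocked\<^sup>*\<^sup>* \<Gamma> \<Delta>"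
  shows "kernel \<Gamma> = kernel \<Delta>"
proof -
  have "finite \<Delta>" using remove_blocked_subset[OF assms(2)] assms(1) finite_subset by blast
  then have "is_kernel \<Gamma> (kernel \<Delta>)"
    using kernel_is_kernel assms(2) unfolding is_kernel_def by (meson rtranclp_trans)
  then show ?thesis using is_kernel_unique kernel_is_kernel[OF assms(1)] by blast
qed

text \<open>\<open>\<Gamma>\<close> is its own kernel, so removals lead from
  \<open>\<Gamma> \<union> \<Lambda>\<close> to \<open>\<Gamma>\<close>. The clause removed last was
  blocked in a larger set, hence is blocked with respect to \<open>\<Gamma>\<close> although it has
  only old variables. So there was no removal at all.\<close>

lemma blocked_extension_trivial:
  assumes "finite \<Gamma>" and "blocked_extension \<Gamma> \<Lambda>" and "cnf_vars \<Lambda> \<subseteq> cnf_vars \<Gamma>"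
    and unblocked: "\<And>C. lits_vars C \<subseteq> cnf_vars \<Gamma> \<Longrightarrow> \<not> blocked C \<Gamma>"
  shows "\<Lambda> \<subseteq> \<Gamma>"
proof -
  have "finite \<Lambda>" "kernel (\<Gamma> \<union> \<Lambda>) = kernel \<Gamma>"
    using assms(2) unfolding blocked_extension_def is_cnf_def by auto
  moreover have "is_kernel \<Gamma> \<Gamma>"
    unfolding is_kernel_def using unblocked by (auto simp: cnf_vars_def)
  ultimately have "is_kernel (\<Gamma> \<union> \<Lambda>) \<Gamma>"
    using kernel_is_kernel is_kernel_unique assms(1) by (metis finite_Un)
  then have "remove_blocked\<^sup>*\<^sup>* (\<Gamma> \<union> \<Lambda>) \<Gamma>" unfolding is_kernel_def by blast
  then show ?thesis
  proof (cases rule: rtranclp.cases)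
    case (rtrancl_into_rtrancl \<Delta>)
    then obtain C where C: "C \<in> \<Delta>" "blocked C \<Delta>" "\<Gamma> = \<Delta> - {C}"
      unfolding remove_blocked_def by blast
    then have "blocked C \<Gamma>" using blocked_antimono by blast
    moreover have "C \<in> \<Gamma> \<union> \<Lambda>" using C(1) remove_blocked_subset rtrancl_into_rtrancl(1) by blast
    then have "lits_vars C \<subseteq> cnf_vars \<Gamma>" using assms(3) unfolding cnf_vars_def by blast
    ultimately show ?thesis using unblocked by blast
  qed blast
qed

section \<open>Simulation of RAT clauses on twin variables\<close>

text \<open>The RAT condition for \<open>p\<close> with respect to the clause \<open>{compl p, b}\<close> of an equivalence of \<open>p\<close> and \<open>b\<close>
  already yields \<open>C\<close> by a resolution with the converse clause \<open>{compl b, p}\<close>.\<close>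

lemma derives_rat_of_twins:
  assumes "is_cnf \<Gamma>" and "finite V" and "cnf_vars \<Gamma> \<subseteq> V" and "lits_vars C \<subseteq> V" and "is_rat C \<Gamma>"
    and twins: "\<And>p. var_of p \<in> V \<Longrightarrow> \<exists>b. var_of b \<noteq> var_of p \<and> {compl p, b} \<in> \<Gamma> \<and> {compl b, p} \<in> \<Gamma>"
  shows "derives res_rule \<Gamma> (card V + 2) {C}"
proof -
  obtain p where p: "p \<in> C" "rat_for p C \<Gamma>" using assms(5) unfolding is_rat_def by blast
  then have cl: "is_clause C" unfolding rat_for_def by simp
  from p obtain C' where C': "C = {p} \<union> C'" "var_of p \<notin> lits_vars C'"
    and up: "\<And>D'. {compl p} \<union> D' \<in> \<Gamma> \<Longrightarrow> var_of p \<notin> lits_vars D' \<Longrightarrow> \<Gamma> \<turnstile>\<^sub>1 C' \<union> D'"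
    unfolding rat_for_def by blast
  have "var_of p \<in> V" using p(1) assms(4) unfolding lits_vars_def by blast
  then obtain b where b: "var_of b \<noteq> var_of p" "{compl p, b} \<in> \<Gamma>" "{compl b, p} \<in> \<Gamma>"
    using twins by blast
  have weak: "res_rule \<Theta> C" if "E \<in> \<Theta>" "E \<subseteq> C" for E \<Theta>
    using that cl is_clause_subset unfolding res_rule_def weakening_def by (metis Un_absorb1)
  show ?thesis
  \<comment> \<open>If \<open>compl b \<in> C'\<close>, then \<open>C' \<union> {b}\<close> is
    tautological and the RAT check says nothing, but \<open>C\<close> is then a weakening of the
    twin clause \<open>{compl b, p}\<close>.\<close>
  proof (cases "compl b \<in> C'")
    case True
    then have "{compl b, p} \<subseteq> C" using C' by auto
    then have "derives res_rule \<Gamma> 1 {C}" using weak b(3) by (intro derives_step)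
    then show ?thesis using derives_weaken by fastforce
  next
    case False
    have "\<Gamma> \<turnstile>\<^sub>1 C' \<union> {b}"
      using b by (intro up) (auto simp: lits_vars_def insert_commute)
    moreover have cb: "is_clause (C' \<union> {b})"
      using False cl C' by (auto simp: is_clause_insert)
    ultimately obtain E where E: "E \<subseteq> C' \<union> {b}"
      "derives res1 \<Gamma> (card (V - lits_vars (C' \<union> {b}))) {E}"
      using derives_of_up_implies[OF assms(1-3)] by blast
    have "derives res1 \<Gamma> (card V) {E}"
      by (rule derives_weaken[OF E(2)]) (auto intro: card_mono assms(2))
    then have dE: "derives res_rule \<Gamma> (card V) {E}"
      unfolding derives_def using steps_rule_mono[of res1 _ _ _ res_rule] res1_res_rule by meson
    show ?thesis
    proof (cases "b \<in> E")
      case False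
      then have "E \<subseteq> C" using E(1) C'(1) by auto
      then have "derives res_rule \<Gamma> (Suc (card V)) {C, E}"
        using weak[of E "\<Gamma> \<union> {E}"] by (intro derives_cut[OF mono_res_rule dE]) auto
      then show ?thesis by (rule derives_weaken) auto
    next
      case True
      let ?R = "(E - {b}) \<union> ({compl b, p} - {compl b})"
      have R: "?R \<subseteq> C" using E(1) C'(1) by auto
      have "res1 (\<Gamma> \<union> {E}) ?R"
      proof (rule res1I[of E _ "{compl b, p}" _ b])
        show "is_clause E" using is_clause_subset[OF cb E(1)] .
        show "is_clause {compl b, p}" using b(3) assms(1) by (auto simp: is_cnf_def)
        show "is_clause ?R" using is_clause_subset[OF cl R] .
      qed (use b True in auto)
      then have "derives res_rule \<Gamma> (Suc (card V)) {?R, E}"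
        by (intro derives_cut[OF mono_res_rule dE] res1_res_rule)
      moreover have "res_rule (\<Gamma> \<union> {?R, E}) C" by (rule weak[OF _ R]) simp
      ultimately have "derives res_rule \<Gamma> (Suc (Suc (card V))) {C, ?R, E}"
        by (rule derives_cut[OF mono_res_rule])
      then show ?thesis by (rule derives_weaken) auto
    qed
  qed
qed

lemma is_clause_rat_rule: "rat_rule \<Gamma> C \<Longrightarrow> is_clause C"
  unfolding rat_rule_def res_rule_def is_rat_def rat_for_def weakening_def
  by (auto dest: resolventD(6))

lemma steps_rat_is_cnf: "steps rat_rule \<Gamma> k \<Delta> \<Longrightarrow> is_cnf \<Gamma> \<Longrightarrow> is_cnf \<Delta>"
  by (induction rule: steps.induct) (auto simp: is_cnf_insert is_clause_rat_rule)

text \<open>The twin clauses belong to the initial CNF and therefore to every later one, so each RAT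
  line can be replaced separately.\<close>

lemma derives_rat_steps_of_twins:
  assumes "steps rat_rule \<Gamma> k \<Delta>" and "is_cnf \<Gamma>" and "finite V" and "cnf_vars \<Delta> \<subseteq> V"
    and twins: "\<And>p. var_of p \<in> V \<Longrightarrow> \<exists>b. var_of b \<noteq> var_of p \<and> {compl p, b} \<in> \<Gamma> \<and> {compl b, p} \<in> \<Gamma>"
  shows "derives res_rule \<Gamma> (k * (card V + 2)) \<Delta>"
  using assms(1,4)
proof (induction rule: steps.induct)
  case steps_0
  then show ?case by (simp add: derives_subset)
next
  case (steps_Suc k \<Delta> C)
  have vars: "cnf_vars \<Delta> \<subseteq> V" "lits_vars C \<subseteq> V" using steps_Suc.prems by (auto simp: cnf_vars_insert)
  have sub: "\<Gamma> \<subseteq> \<Delta>" using steps_subset steps_Suc.hyps(1) by blast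
  have "derives res_rule \<Delta> (card V + 2) {C}"
  proof (cases "res_rule \<Delta> C")
    case True
    then show ?thesis by (rule derives_weaken[OF derives_step]) auto
  next
    case False
    then have "is_rat C \<Delta>" using steps_Suc.hyps(2) unfolding rat_rule_def by blast
    then show ?thesis
      using steps_rat_is_cnf[OF steps_Suc.hyps(1) assms(2)] assms(3) vars twins sub
      by (intro derives_rat_of_twins) (auto, meson subsetD)
  qed
  then have "derives res_rule (\<Gamma> \<union> \<Delta>) (card V + 2) {C}" using sub by (simp add: Un_absorb1)
  from derives_trans[OF mono_res_rule steps_Suc.IH[OF vars(1)] this]
  show ?case by (simp add: algebra_simps)
qed

section \<open>Extension clauses as RATs\<close>

text \<open>A clash on a second literal makes the set to be refuted tautological; otherwise a clause
  of \<open>\<Gamma>\<close> lies inside it and is falsified at once. The condition speaks of all of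
  \<open>\<Gamma> \<union> X\<close>, so the order of the additions does not matter.\<close>

lemma steps_rat_of_clash:
  assumes "finite X" and "is_cnf \<Gamma>" and "Y \<subseteq> X"
    and X: "\<And>C. C \<in> X \<Longrightarrow> is_clause C \<and> (\<exists>p\<in>C. \<forall>D\<in>\<Gamma> \<union> X. compl p \<in> D \<longrightarrow>
      (\<exists>r\<in>C. r \<noteq> p \<and> compl r \<in> D) \<or> (\<exists>D0\<in>\<Gamma>. D0 \<subseteq> D - {compl p}))"
  shows "steps rat_rule \<Gamma> (card Y) (\<Gamma> \<union> Y)"
proof -
  have "finite Y" using assms(1,3) finite_subset by blast
  then show ?thesis using assms(3)
  proof (induction Y)
    case empty
    then show ?case by (simp add: steps_0)
  next
    case (insert C Y)
    then have C: "C \<in> X" and s: "steps rat_rule \<Gamma> (card Y) (\<Gamma> \<union> Y)" by auto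
    have cnf: "is_cnf (\<Gamma> \<union> Y)" using steps_rat_is_cnf[OF s] assms(2) by blast
    obtain p where p: "p \<in> C" and clash: "\<And>D. D \<in> \<Gamma> \<union> X \<Longrightarrow> compl p \<in> D \<Longrightarrow>
      (\<exists>r\<in>C. r \<noteq> p \<and> compl r \<in> D) \<or> (\<exists>D0\<in>\<Gamma>. D0 \<subseteq> D - {compl p})" using X[OF C] by meson
    have cl: "is_clause C" using X[OF C] by blast
    have "rat_for p C (\<Gamma> \<union> Y)"
      unfolding rat_for_def
    proof (intro conjI exI[of _ "C - {p}"] allI impI)
      show "var_of p \<notin> lits_vars (C - {p})"
        using cl p unfolding var_in_lits_vars_iff is_clause_def tautological_iff by auto
      fix D' assume D': "{compl p} \<union> D' \<in> \<Gamma> \<union> Y \<and> var_of p \<notin> lits_vars D'"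
      then have fin: "finite (C - {p} \<union> D')"
        using cl cnf unfolding is_clause_def is_cnf_def by (metis finite_Diff finite_Un)
      have "{compl p} \<union> D' \<in> \<Gamma> \<union> X" using D' insert.prems by auto
      from clash[OF this] have "(\<exists>r\<in>C. r \<noteq> p \<and> compl r \<in> {compl p} \<union> D') \<or>
        (\<exists>D0\<in>\<Gamma>. D0 \<subseteq> {compl p} \<union> D' - {compl p})" by simp
      then show "\<Gamma> \<union> Y \<turnstile>\<^sub>1 C - {p} \<union> D'"
      proof
        assume "\<exists>r\<in>C. r \<noteq> p \<and> compl r \<in> {compl p} \<union> D'"
        then obtain r where "r \<in> C - {p}" "compl r \<in> D'" by (metis Diff_iff UnE compl_compl singletonD)
        then have "tautological (C - {p} \<union> D')" unfolding tautological_iff by blast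
        then show ?thesis using up_implies_tautological[OF cnf fin] by blast
      next
        assume "\<exists>D0\<in>\<Gamma>. D0 \<subseteq> {compl p} \<union> D' - {compl p}"
        then show ?thesis using up_implies_superset[OF cnf fin] by blast
      qed
    qed (use cl p in auto)
    then have "rat_rule (\<Gamma> \<union> Y) C" using p unfolding rat_rule_def is_rat_def by blast
    then show ?case using steps_Suc[OF s] insert.hyps by simp
  qed
qed

section \<open>Formulas without blocked clauses\<close>

definition weakenings :: "'v set \<Rightarrow> 'v cnf \<Rightarrow> 'v cnf" where
  "weakenings V F = F \<union> {insert p D | p D. D \<in> F \<and> var_of p \<in> V \<and> compl p \<notin> D}"

text \<open>If \<open>p\<close> is true and the other literals of \<open>C\<close> are false, then some clause \<open>D\<close> of \<open>F\<close> is falsified, and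
  \<open>C\<close> is not blocked for \<open>p\<close> because of the weakening of \<open>D\<close> by \<open>compl p\<close>.\<close>

lemma not_blocked_weakenings:
  assumes unsat: "\<And>\<alpha>. \<exists>D\<in>F. falsifies \<alpha> D" and "lits_vars C \<subseteq> V"
  shows "\<not> blocked C (weakenings V F)"
proof
  assume "blocked C (weakenings V F)"
  then obtain p C' where p: "is_clause C" "C = {p} \<union> C'" "var_of p \<notin> lits_vars C'"
    and taut: "\<And>D'. {compl p} \<union> D' \<in> weakenings V F \<Longrightarrow> var_of p \<notin> lits_vars D' \<Longrightarrow>
      tautological (C' \<union> D')"
    unfolding blocked_def blocked_for_def by blast
  \<comment> \<open>Makes \<open>p\<close> true and all of \<open>C'\<close> false; variables
    outside \<open>C\<close> get the default value false.\<close>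
  define \<alpha> where "\<alpha> = (\<lambda>x. Pos x = p \<or> Neg x \<in> C')"
  have tp: "lit_true \<alpha> p"
    using p(3) by (cases p) (auto simp: \<alpha>_def lits_vars_iff)
  have "\<not> lit_true \<alpha> r" if "r \<in> C'" for r
    using that p by (cases r; cases p) (auto simp: \<alpha>_def lits_vars_iff is_clause_def tautological_def)
  then have fC: "falsifies \<alpha> C'" unfolding falsifies_def by blast
  obtain D where D: "D \<in> F" "falsifies \<alpha> D" using unsat by blast
  then have pD: "p \<notin> D" using tp unfolding falsifies_def by blast
  have "var_of (compl p) \<in> V" using assms(2) p(2) by (auto simp: lits_vars_def)
  then have "insert (compl p) D \<in> weakenings V F"
    unfolding weakenings_def using D pD by (metis (mono_tags, lifting) UnI2 compl_compl mem_Collect_eq)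
  then have "{compl p} \<union> (D - {compl p}) \<in> weakenings V F" by simp
  then have "tautological (C' \<union> (D - {compl p}))"
    using taut pD by (simp add: var_in_lits_vars_iff)
  moreover have "falsifies \<alpha> (C' \<union> (D - {compl p}))" using fC D unfolding falsifies_def by blast
  ultimately show False unfolding tautological_iff falsifies_def by (metis lit_true_compl)
qed

lemma is_cnf_weakenings:
  assumes "is_cnf F" and "finite V"
  shows "is_cnf (weakenings V F)"
proof -
  have "{insert p D | p D. D \<in> F \<and> var_of p \<in> V \<and> compl p \<notin> D}
      \<subseteq> (\<lambda>(p, D). insert p D) ` ((Pos ` V \<union> Neg ` V) \<times> F)"
  proof clarify
    fix p D assume "D \<in> F" "var_of p \<in> V"
    then show "insert p D \<in> (\<lambda>(p, D). insert p D) ` ((Pos ` V \<union> Neg ` V) \<times> F)"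
      by (cases p) force+
  qed
  then have "finite {insert p D | p D. D \<in> F \<and> var_of p \<in> V \<and> compl p \<notin> D}"
    using assms by (rule_tac finite_subset) (auto simp: is_cnf_def)
  then show ?thesis using assms unfolding is_cnf_def weakenings_def by (auto simp: is_clause_insert)
qed

lemma cnf_vars_weakenings:
  assumes "cnf_vars F \<subseteq> V" and "D \<in> F" and "\<And>x. Neg x \<notin> D"
  shows "cnf_vars (weakenings V F) = V"
proof
  show "cnf_vars (weakenings V F) \<subseteq> V"
    using assms(1) unfolding weakenings_def cnf_vars_def lits_vars_def by auto
  show "V \<subseteq> cnf_vars (weakenings V F)"
  proof
    fix x assume "x \<in> V"
    then have "var_of (Pos x) \<in> V" "compl (Pos x) \<notin> D" using assms(3) by auto
    then have "insert (Pos x) D \<in> weakenings V F" unfolding weakenings_def using assms(2) by blast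
    moreover have "x \<in> lits_vars (insert (Pos x) D)" by (simp add: lits_vars_iff)
    ultimately show "x \<in> cnf_vars (weakenings V F)" unfolding cnf_vars_def by blast
  qed
qed

section \<open>The pigeonhole principle and its extension variables\<close>

text \<open>\<open>pvar k i j\<close> is the variable of Cook's level \<open>k\<close> for pigeon \<open>i\<close> and hole \<open>j\<close>. Odd numbers are
  reserved for twins.\<close>

definition pvar :: "nat \<Rightarrow> nat \<Rightarrow> nat \<Rightarrow> nat" where
  "pvar k i j = 2 * prod_encode (k, prod_encode (i, j))"

lemma pvar_inject [simp]: "pvar k i j = pvar k' i' j' \<longleftrightarrow> k = k' \<and> i = i' \<and> j = j'"
  unfolding pvar_def by simp

lemma pvar_neq_Suc [simp]: "pvar k i j \<noteq> Suc (pvar k' i' j')"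
  unfolding pvar_def by presburger

definition pigeon_clause :: "nat \<Rightarrow> nat \<Rightarrow> nat clause" where
  "pigeon_clause k i = Pos ` pvar k i ` {..<k}"

definition hole_clause :: "nat \<Rightarrow> nat \<Rightarrow> nat \<Rightarrow> nat \<Rightarrow> nat clause" where
  "hole_clause k i i' j = {Neg (pvar k i j), Neg (pvar k i' j)}"

definition php :: "nat \<Rightarrow> nat cnf" where
  "php k = pigeon_clause k ` {..k} \<union>
    {hole_clause k i i' j | i i' j. i \<le> k \<and> i' \<le> k \<and> i \<noteq> i' \<and> j < k}"

lemma hole_clause_in_php:
  "i \<le> k \<Longrightarrow> i' \<le> k \<Longrightarrow> i \<noteq> i' \<Longrightarrow> j < k \<Longrightarrow> hole_clause k i i' j \<in> php k"
  unfolding php_def by blast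

text \<open>Cook's definition of level \<open>k\<close>: the pigeon \<open>i\<close> sits in hole \<open>j\<close> if it did so on level \<open>Suc k\<close>,
  or if it sat in the last hole and the last pigeon sat in \<open>j\<close>.\<close>

definition def_clauses :: "nat \<Rightarrow> nat \<Rightarrow> nat \<Rightarrow> nat cnf" where
  "def_clauses k i j =
    {{Pos (pvar k i j), Neg (pvar (Suc k) i j)},
     {Pos (pvar k i j), Neg (pvar (Suc k) (Suc k) j), Neg (pvar (Suc k) i k)},
     {Neg (pvar k i j), Pos (pvar (Suc k) i j), Pos (pvar (Suc k) i k)},
     {Neg (pvar k i j), Pos (pvar (Suc k) i j), Pos (pvar (Suc k) (Suc k) j)}}"

definition ext :: "nat \<Rightarrow> nat cnf" where
  "ext k = (\<Union>i\<le>k. \<Union>j<k. def_clauses k i j)"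

definition exts :: "nat \<Rightarrow> nat \<Rightarrow> nat cnf" where
  "exts l N = (\<Union>k\<in>{l..<N}. ext k)"

lemma ext_cases:
  assumes "C \<in> ext k"
  obtains i j where "i \<le> k" "j < k" "C \<in> def_clauses k i j"
  using assms unfolding ext_def by blast

lemma exts_step:
  assumes "l < N"
  shows "exts l N = exts (Suc l) N \<union> ext l"
proof -
  have "{l..<N} = insert l {Suc l..<N}" using assms by auto
  then show ?thesis unfolding exts_def by auto
qed

lemma def_clausesI: "i \<le> k \<Longrightarrow> j < k \<Longrightarrow> C \<in> def_clauses k i j \<Longrightarrow> C \<in> ext k"
  unfolding ext_def by blast

lemma is_clause_def_clauses: "C \<in> def_clauses k i j \<Longrightarrow> is_clause C"
  unfolding def_clauses_def by (auto simp: is_clause_insert)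

lemma is_cnf_ext: "is_cnf (ext k)"
  unfolding is_cnf_def
proof
  show "finite (ext k)" unfolding ext_def def_clauses_def by simp
qed (auto elim!: ext_cases simp: is_clause_def_clauses)

lemma is_cnf_exts: "is_cnf (exts l N)"
  using is_cnf_ext unfolding exts_def is_cnf_def by blast

lemma is_cnf_php: "is_cnf (php k)"
  unfolding is_cnf_def
proof
  have "{hole_clause k i i' j | i i' j. i \<le> k \<and> i' \<le> k \<and> i \<noteq> i' \<and> j < k}
    \<subseteq> (\<lambda>(i, i', j). hole_clause k i i' j) ` ({..k} \<times> {..k} \<times> {..<k})" by force
  from finite_subset[OF this] show "finite (php k)" unfolding php_def by simp
  show "\<forall>C\<in>php k. is_clause C"
    unfolding php_def pigeon_clause_def hole_clause_def
    by (auto simp: is_clause_insert) (auto simp: is_clause_def tautological_def)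
qed

section \<open>Ranges of the variables, and the extension clauses as blocked clauses and as
  RATs\<close>

definition box :: "nat \<Rightarrow> nat set" where
  "box N = (\<lambda>(k, i, j). pvar k i j) ` ({..N} \<times> {..N} \<times> {..N})"

lemma box_iff: "pvar k i j \<in> box N \<longleftrightarrow> k \<le> N \<and> i \<le> N \<and> j \<le> N"
  unfolding box_def by force

lemma finite_box: "finite (box N)"
  unfolding box_def by simp

lemma card_box: "card (box N) \<le> (N + 1) ^ 3"
proof -
  have "card (box N) \<le> card ({..N} \<times> {..N} \<times> {..N})" unfolding box_def by (intro card_image_le) auto
  then show ?thesis by (simp add: card_cartesian_product power3_eq_cube algebra_simps)
qed

lemma php_vars:
  assumes "v \<in> cnf_vars (php N)"
  obtains i j where "v = pvar N i j" "i \<le> N" "j \<le> N"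
  using assms unfolding cnf_vars_def php_def pigeon_clause_def hole_clause_def lits_vars_def
  by auto

lemma ext_vars:
  assumes "v \<in> cnf_vars (ext k)"
  obtains l i j where "v = pvar l i j" "k \<le> l" "l \<le> Suc k" "i \<le> Suc k" "j \<le> Suc k"
proof -
  from assms obtain C where C: "C \<in> ext k" "v \<in> lits_vars C" unfolding cnf_vars_def by blast
  from C(1) obtain i j where ij: "i \<le> k" "j < k" "C \<in> def_clauses k i j" by (rule ext_cases)
  then have "v = pvar k i j \<or> v = pvar (Suc k) i j \<or> v = pvar (Suc k) (Suc k) j \<or> v = pvar (Suc k) i k"
    using C(2) unfolding def_clauses_def lits_vars_def by auto
  then show ?thesis
    using that[of k i j] that[of "Suc k" i j] that[of "Suc k" "Suc k" j] that[of "Suc k" i k] ij by auto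
qed

lemma exts_vars:
  assumes "v \<in> cnf_vars (exts l N)"
  obtains k i j where "v = pvar k i j" "l \<le> k" "k \<le> N" "i \<le> N" "j \<le> N"
proof -
  from assms obtain C where C: "C \<in> exts l N" "v \<in> lits_vars C" unfolding cnf_vars_def by blast
  from C(1) obtain k where k: "l \<le> k" "k < N" "C \<in> ext k" unfolding exts_def by auto
  then have "v \<in> cnf_vars (ext k)" using C(2) unfolding cnf_vars_def by blast
  then obtain k' i j where "v = pvar k' i j" "k \<le> k'" "k' \<le> Suc k" "i \<le> Suc k" "j \<le> Suc k"
    by (rule ext_vars)
  then show ?thesis using that[of k' i j] k by simp
qed

lemma cnf_vars_php: "cnf_vars (php N) \<subseteq> box N"
  by (auto elim!: php_vars simp: box_iff)

lemma cnf_vars_exts: "cnf_vars (exts l N) \<subseteq> box N"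
  by (auto elim!: exts_vars simp: box_iff)

lemma card_exts: "card (exts 0 N) \<le> 4 * (N + 1) ^ 3"
proof -
  let ?I = "{..N} \<times> {..N} \<times> {..N}"
  have sub: "exts 0 N \<subseteq> (\<Union>(k, i, j)\<in>?I. def_clauses k i j)"
  proof
    fix C assume "C \<in> exts 0 N"
    then obtain k where k: "k < N" "C \<in> ext k" unfolding exts_def by auto
    from k(2) obtain i j where "i \<le> k" "j < k" "C \<in> def_clauses k i j" by (rule ext_cases)
    then show "C \<in> (\<Union>(k, i, j)\<in>?I. def_clauses k i j)" using k(1) by (intro UN_I[of "(k, i, j)"]) auto
  qed
  have four: "card (def_clauses k i j) \<le> 4" for k i j
    unfolding def_clauses_def by (simp add: card_insert_if)
  have "card (exts 0 N) \<le> card (\<Union>(k, i, j)\<in>?I. def_clauses k i j)"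
    using sub by (intro card_mono) (auto simp: def_clauses_def)
  also have "\<dots> \<le> (\<Sum>(k, i, j)\<in>?I. card (def_clauses k i j))"
    using card_UN_le[of ?I "\<lambda>(k, i, j). def_clauses k i j"] by (simp add: case_prod_unfold)
  also have "\<dots> \<le> (\<Sum>_\<in>?I. 4)" using four by (intro sum_mono) auto
  also have "\<dots> = 4 * (N + 1) ^ 3"
    by (simp add: card_cartesian_product power3_eq_cube algebra_simps)
  finally show ?thesis .
qed

lemma php_unsat: "\<exists>D\<in>php N. falsifies \<alpha> D"
proof (rule ccontr)
  assume none: "\<not> ?thesis"
  have "\<exists>j<N. \<alpha> (pvar N i j)" if "i \<le> N" for i
  proof -
    have "pigeon_clause N i \<in> php N" using that unfolding php_def by auto
    then obtain p where "p \<in> pigeon_clause N i" "lit_true \<alpha> p"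
      using none unfolding falsifies_def by blast
    then show ?thesis unfolding pigeon_clause_def by auto
  qed
  then obtain h where h: "\<And>i. i \<le> N \<Longrightarrow> h i < N \<and> \<alpha> (pvar N i (h i))" by metis
  have "inj_on h {..N}"
  proof (rule inj_onI, rule ccontr)
    fix i i' assume i: "i \<in> {..N}" "i' \<in> {..N}" "h i = h i'" "i \<noteq> i'"
    then have "hole_clause N i i' (h i) \<in> php N" using h by (intro hole_clause_in_php) auto
    moreover have "falsifies \<alpha> (hole_clause N i i' (h i))"
      using h[of i] h[of i'] i unfolding hole_clause_def falsifies_def by auto
    ultimately show False using none by blast
  qed
  then have "card {..N} \<le> card {..<N}" by (rule card_inj_on_le) (use h in auto)
  then show False by simp
qed

text \<open>The pivot is the defined variable. The clauses define \<open>x\<close> as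
  \<open>a\<close> or (\<open>b\<close> and \<open>d\<close>), and any two with opposite signs of
  \<open>x\<close> also disagree on \<open>a\<close>, \<open>b\<close> or \<open>d\<close>, as for
  every extension definition.\<close>

lemma ext_clash:
  assumes "C \<in> ext k"
  shows "\<exists>p\<in>C. (\<exists>i j. var_of p = pvar k i j) \<and>
    (\<forall>D\<in>ext k. compl p \<in> D \<longrightarrow> (\<exists>r\<in>C. r \<noteq> p \<and> compl r \<in> D))"
proof -
  from assms obtain i j where ij: "i \<le> k" "j < k" "C \<in> def_clauses k i j" by (rule ext_cases)
  have "\<exists>p\<in>C. var_of p = pvar k i j \<and>
    (\<forall>D\<in>def_clauses k i j. compl p \<in> D \<longrightarrow> (\<exists>r\<in>C. r \<noteq> p \<and> compl r \<in> D))"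
    using ij(3) unfolding def_clauses_def by auto
  then obtain p where p: "p \<in> C" "var_of p = pvar k i j"
    "\<And>D. D \<in> def_clauses k i j \<Longrightarrow> compl p \<in> D \<Longrightarrow> \<exists>r\<in>C. r \<noteq> p \<and> compl r \<in> D" by blast
  have "D \<in> def_clauses k i j" if D: "D \<in> ext k" "compl p \<in> D" for D
  proof -
    from D(1) obtain i' j' where D': "D \<in> def_clauses k i' j'" by (rule ext_cases)
    have "pvar k i j \<in> lits_vars D" using D(2) p(2) unfolding lits_vars_def by force
    then have "i' = i \<and> j' = j" using D' unfolding def_clauses_def lits_vars_def by auto
    then show ?thesis using D' by simp
  qed
  then show ?thesis using p by blast
qed

lemma var_notin_higher:
  assumes "D \<in> php N \<union> exts (Suc k) N" and "k < N"
  shows "pvar k i j \<notin> lits_vars D"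
proof
  assume "pvar k i j \<in> lits_vars D"
  then have "pvar k i j \<in> cnf_vars (php N) \<or> pvar k i j \<in> cnf_vars (exts (Suc k) N)"
    using assms(1) unfolding cnf_vars_def by blast
  then show False using assms(2) by (auto elim!: php_vars exts_vars)
qed

text \<open>The lowest level goes first: its variables are absent from \<open>php N\<close> and from
  the higher levels, so only clauses of the same level have to clash.\<close>

lemma remove_exts: "l \<le> N \<Longrightarrow> remove_blocked\<^sup>*\<^sup>* (php N \<union> exts l N) (php N)"
proof (induction l rule: inc_induct)
  case base
  then show ?case by (simp add: exts_def)
next
  case (step l)
  have "remove_blocked\<^sup>*\<^sup>* ((php N \<union> exts (Suc l) N) \<union> ext l) (php N \<union> exts (Suc l) N)"
  proof (rule remove_blocked_Un)
    show "finite (ext l)" using is_cnf_ext unfolding is_cnf_def by blast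
    fix C assume C: "C \<in> ext l"
    then obtain p where p: "p \<in> C" "\<exists>i j. var_of p = pvar l i j"
      "\<And>D. D \<in> ext l \<Longrightarrow> compl p \<in> D \<Longrightarrow> \<exists>r\<in>C. r \<noteq> p \<and> compl r \<in> D"
      using ext_clash by meson
    have "blocked_for p C (php N \<union> exts (Suc l) N \<union> ext l)"
    proof (rule blocked_forI)
      show "is_clause C" using C is_cnf_ext unfolding is_cnf_def by blast
      fix D assume D: "D \<in> php N \<union> exts (Suc l) N \<union> ext l" "compl p \<in> D"
      then have "var_of p \<in> lits_vars D" by (simp add: var_in_lits_vars_iff)
      then have "D \<notin> php N \<union> exts (Suc l) N" using p(2) var_notin_higher[OF _ step.hyps(2)] by metis
      then have "D \<in> ext l" using D(1) by blast
      then show "\<exists>r\<in>C. r \<noteq> p \<and> compl r \<in> D" using p(3) D(2) by blast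
    qed (use p in auto)
    then show "blocked C (php N \<union> exts (Suc l) N \<union> ext l)" using p(1) unfolding blocked_def by blast
  qed
  moreover have "php N \<union> exts l N = (php N \<union> exts (Suc l) N) \<union> ext l"
    using exts_step step.hyps by auto
  ultimately show ?case using step.IH by simp
qed

lemma steps_rat_exts:
  assumes "l \<le> N"
  defines "\<Gamma> \<equiv> weakenings (box N) (php N)"
  shows "\<exists>k\<le>card (exts l N). steps rat_rule \<Gamma> k (\<Gamma> \<union> exts l N)"
  using assms(1)
proof (induction l rule: inc_induct)
  case base
  then show ?case by (simp add: exts_def steps_0)
next
  case (step l)
  let ?\<Delta> = "\<Gamma> \<union> exts (Suc l) N"
  let ?X = "ext l - exts (Suc l) N"
  have "is_cnf ?\<Delta>" unfolding is_cnf_Un \<Gamma>_def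
    using is_cnf_weakenings is_cnf_php finite_box is_cnf_exts by blast
  have "steps rat_rule ?\<Delta> (card ?X) (?\<Delta> \<union> ?X)"
  proof (rule steps_rat_of_clash[OF _ \<open>is_cnf ?\<Delta>\<close> order.refl])
    show "finite ?X" using is_cnf_ext unfolding is_cnf_def by blast
    fix C assume C: "C \<in> ?X"
    then obtain p where p: "p \<in> C" "\<exists>i j. var_of p = pvar l i j"
      "\<And>D. D \<in> ext l \<Longrightarrow> compl p \<in> D \<Longrightarrow> \<exists>r\<in>C. r \<noteq> p \<and> compl r \<in> D"
      using ext_clash by (metis DiffD1)
    have "(\<exists>r\<in>C. r \<noteq> p \<and> compl r \<in> D) \<or> (\<exists>D0\<in>?\<Delta>. D0 \<subseteq> D - {compl p})"
      if D: "D \<in> ?\<Delta> \<union> ?X" "compl p \<in> D" for D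
    proof (cases "D \<in> ext l")
      case True
      then show ?thesis using p(3) D(2) by blast
    next
      case False
      have notin: "compl p \<notin> E" if "E \<in> php N \<union> exts (Suc l) N" for E
        using var_notin_higher[OF that] step.hyps p(2) var_in_lits_vars_iff[of p E] by metis
      \<comment> \<open>The pivot has level \<open>l\<close>, so outside \<open>ext l\<close> it
        occurs only as the literal by which a clause of \<open>php N\<close> was weakened; that
        clause is the required \<open>D0\<close>.\<close>
      then have "D \<in> weakenings (box N) (php N) - php N" using D False unfolding \<Gamma>_def by blast
      then obtain p' D0 where D0: "D = insert p' D0" "D0 \<in> php N" unfolding weakenings_def by blast
      then have "compl p \<notin> D0" using notin by blast
      then have "D0 \<subseteq> D - {compl p}" using D0 by blast
      moreover have "D0 \<in> ?\<Delta>" using D0 unfolding \<Gamma>_def weakenings_def by blast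
      ultimately show ?thesis by blast
    qed
    moreover have "is_clause C" using C is_cnf_ext unfolding is_cnf_def by blast
    ultimately show "is_clause C \<and> (\<exists>p\<in>C. \<forall>D\<in>?\<Delta> \<union> ?X. compl p \<in> D \<longrightarrow>
      (\<exists>r\<in>C. r \<noteq> p \<and> compl r \<in> D) \<or> (\<exists>D0\<in>?\<Delta>. D0 \<subseteq> D - {compl p}))" using p(1) by blast
  qed
  moreover obtain k where k: "k \<le> card (exts (Suc l) N)" "steps rat_rule \<Gamma> k ?\<Delta>"
    using step.IH by blast
  moreover have "?\<Delta> \<union> ?X = \<Gamma> \<union> exts l N" using exts_step step.hyps by auto
  ultimately have "steps rat_rule \<Gamma> (k + card ?X) (\<Gamma> \<union> exts l N)" using steps_trans by metis
  moreover have "card (exts l N) = card (exts (Suc l) N) + card ?X"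
  proof -
    have "exts l N = exts (Suc l) N \<union> ?X" using exts_step step.hyps by auto
    then show ?thesis
      using is_cnf_ext is_cnf_exts unfolding is_cnf_def
      by (metis card_Un_disjoint Diff_disjoint finite_Diff)
  qed
  ultimately show ?case using k(1) by (metis add_le_mono1)
qed

section \<open>Short refutations with extension variables\<close>

lemma derives_res1:
  assumes "derives res1 \<Gamma> m A" "P \<in> \<Gamma> \<union> A" "Q \<in> \<Gamma> \<union> A" "p \<in> P" "compl p \<in> Q"
    "is_clause P" "is_clause Q" "is_clause R" "R = (P - {p}) \<union> (Q - {compl p})"
  shows "derives res1 \<Gamma> (Suc m) (insert R A)"
  using derives_cut[OF mono_res1 assms(1)] res1I assms by metis

lemma is_clause_Pos_Un:
  assumes "is_clause A" and "finite X" and "lits_vars A \<inter> X = {}"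
  shows "is_clause (Pos ` X \<union> A)"
  using assms unfolding is_clause_def tautological_def by (auto simp: lits_vars_iff disjoint_iff)

text \<open>Hybrid clauses: in \<open>?T r\<close> the first \<open>r\<close> literals are already
  replaced, and each further one costs one resolution. The side literals \<open>B\<close> disappear
  in \<open>A\<close>.\<close>

lemma derives_replace:
  fixes u x :: "nat \<Rightarrow> 'v"
  assumes rule: "\<And>j. j < k \<Longrightarrow> insert (Pos (x j)) (insert (Neg (u j)) B) \<in> \<Gamma>"
    and start: "derives res1 \<Gamma> m {Pos ` u ` {..<k} \<union> A}"
    and B: "B \<subseteq> A" and A: "is_clause A"
    and inj: "inj_on u {..<k}" and disj: "x ` {..<k} \<inter> u ` {..<k} = {}"
      "lits_vars A \<inter> x ` {..<k} = {}" "lits_vars A \<inter> u ` {..<k} = {}"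
  shows "derives res1 \<Gamma> (m + k) {Pos ` x ` {..<k} \<union> A}"
proof -
  let ?T = "\<lambda>r. Pos ` (x ` {..<r} \<union> u ` {r..<k}) \<union> A"
  have cl: "is_clause (?T r)" if "r \<le> k" for r
    using disj that by (intro is_clause_Pos_Un A) auto
  have "derives res1 \<Gamma> (m + r) {?T r}" if "r \<le> k" for r
    using that
  proof (induction r)
    case 0
    then show ?case using start by (simp add: lessThan_atLeast0)
  next
    case (Suc r)
    let ?E = "insert (Pos (x r)) (insert (Neg (u r)) B)"
    have r: "r < k" using Suc.prems by simp
    have ur: "u r \<notin> lits_vars A" "u r \<notin> x ` {..<k}" "x r \<notin> lits_vars A" "x r \<noteq> u r"
      using disj r by auto
    have "derives res1 \<Gamma> (Suc (m + r)) (insert (?T (Suc r)) {?T r})"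
    proof (rule derives_res1[of _ _ _ "?T r" ?E "Pos (u r)"])
      show "derives res1 \<Gamma> (m + r) {?T r}" using Suc by simp
      show "is_clause ?E" using is_clause_subset[OF A B] ur B
        by (auto simp: is_clause_insert lits_vars_iff)
      have split: "{r..<k} = insert r {Suc r..<k}" "{..<Suc r} = insert r {..<r}" using r by auto
      have "u r \<notin> u ` {Suc r..<k}" using inj r by (auto dest: inj_onD)
      moreover have "u r \<notin> x ` {..<r}" using ur(2) r by auto
      ultimately have "?T r - {Pos (u r)} = Pos ` (x ` {..<r} \<union> u ` {Suc r..<k}) \<union> A"
        using ur(1) unfolding split by (auto simp: lits_vars_iff)
      moreover have "?E - {compl (Pos (u r))} = insert (Pos (x r)) B"
        using ur(1) B by (auto simp: lits_vars_iff)
      ultimately show "?T (Suc r) = (?T r - {Pos (u r)}) \<union> (?E - {compl (Pos (u r))})"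
        using B unfolding split(2) by auto
    qed (use cl rule r Suc.prems in auto)
    then show ?case using derives_weaken[of res1 \<Gamma> _ "{?T (Suc r), ?T r}" "{?T (Suc r)}"] by simp
  qed
  from this[of k] show ?thesis by simp
qed

text \<open>Case distinction on whether pigeon \<open>i\<close> sat in the last hole
  (\<open>?b\<close>). If not, its old pigeon clause is translated literal by literal. If so, the
  last pigeon sat elsewhere, and its clause is translated instead. Resolving on \<open>?b\<close>
  gives \<open>k + (k + 1) + 1\<close> steps.\<close>

lemma derives_pigeon_clause:
  assumes i: "i \<le> k"
  shows "derives res1 (php (Suc k) \<union> ext k) (2 * k + 2) {pigeon_clause k i}"
proof -
  let ?\<Gamma> = "php (Suc k) \<union> ext k"
  let ?b = "pvar (Suc k) i k" and ?d = "pvar (Suc k) (Suc k) k"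
  let ?X = "Pos ` pvar k i ` {..<k}"
  have pigeon: "Pos ` pvar (Suc k) i' ` {..<k} \<union> {Pos (pvar (Suc k) i' k)} \<in> ?\<Gamma>"
    if "i' \<le> Suc k" for i'
  proof -
    have "pigeon_clause (Suc k) i' \<in> php (Suc k)" using that unfolding php_def by blast
    then show ?thesis unfolding pigeon_clause_def by (simp add: lessThan_Suc)
  qed
  have def: "C \<in> ?\<Gamma>" if "C \<in> def_clauses k i j" "j < k" for C j
    using that i def_clausesI by blast
  have "insert (Pos (pvar k i j)) (insert (Neg (pvar (Suc k) i j)) {}) \<in> ?\<Gamma>" if "j < k" for j
    by (rule def[OF _ that]) (simp add: def_clauses_def)
  then have 1: "derives res1 ?\<Gamma> (0 + k) {?X \<union> {Pos ?b}}"
    by (rule derives_replace)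
      (use i pigeon[of i] in \<open>auto simp: derives_subset is_clause_singleton inj_on_def lits_vars_def\<close>)
  let ?c = "Pos ` pvar (Suc k) (Suc k) ` {..<k}"
  have "derives res1 ?\<Gamma> (Suc 0) {?c \<union> {Neg ?b}}"
  proof (rule derives_res1[of _ _ _ "?c \<union> {Pos ?d}" "{Neg ?b, Neg ?d}" "Pos ?d"])
    have "hole_clause (Suc k) i (Suc k) k \<in> php (Suc k)" using i by (intro hole_clause_in_php) auto
    then show "{Neg ?b, Neg ?d} \<in> ?\<Gamma> \<union> {}" unfolding hole_clause_def by simp
    show "?c \<union> {Neg ?b} = (?c \<union> {Pos ?d} - {Pos ?d}) \<union> ({Neg ?b, Neg ?d} - {compl (Pos ?d)})"
      using i by auto
    show "is_clause (?c \<union> {Neg ?b})"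
      using i by (intro is_clause_Pos_Un) (auto simp: lits_vars_def is_clause_singleton)
    show "is_clause (?c \<union> {Pos ?d})"
      by (intro is_clause_Pos_Un) (auto simp: lits_vars_def is_clause_singleton)
  qed (use pigeon[of "Suc k"] in \<open>auto simp: derives_subset is_clause_insert\<close>)
  note start = this
  have "insert (Pos (pvar k i j)) (insert (Neg (pvar (Suc k) (Suc k) j)) {Neg ?b}) \<in> ?\<Gamma>"
    if "j < k" for j by (rule def[OF _ that]) (simp add: def_clauses_def)
  note def_last = this
  have 2: "derives res1 ?\<Gamma> (Suc 0 + k) {?X \<union> {Neg ?b}}"
    by (rule derives_replace[OF def_last start])
      (use i in \<open>auto simp: is_clause_singleton inj_on_def lits_vars_def\<close>)
  have "derives res1 ?\<Gamma> (Suc ((0 + k) + (Suc 0 + k))) (insert ?X ({?X \<union> {Pos ?b}} \<union> {?X \<union> {Neg ?b}}))"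
  proof (rule derives_res1[of _ _ _ "?X \<union> {Pos ?b}" "?X \<union> {Neg ?b}" "Pos ?b"])
    show "is_clause (?X \<union> {Pos ?b})" "is_clause (?X \<union> {Neg ?b})"
      by (intro is_clause_Pos_Un; auto simp: lits_vars_def is_clause_singleton)+
    show "is_clause ?X" using is_clause_Pos_Un[of "{}"] by (auto simp: lits_vars_def)
  qed (use derives_union[OF mono_res1 1 2] in auto)
  then show ?thesis unfolding pigeon_clause_def by (rule derives_weaken) auto
qed

text \<open>Here \<open>x1\<close> abbreviates \<open>a1\<close> or (\<open>b1\<close> and
  \<open>c\<close>), and likewise \<open>x2\<close> with the same \<open>c\<close>. If both hold,
  then \<open>a1\<close> or \<open>a2\<close> holds because \<open>b1\<close> and \<open>b2\<close>
  exclude each other (\<open>?C2\<close>); but \<open>x2\<close> refutes \<open>a1\<close>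
  (\<open>?C4\<close>) and \<open>x1\<close> refutes \<open>a2\<close> (\<open>?C6\<close>).\<close>

lemma derives_merged_hole_clause:
  assumes "distinct [x1, x2, a1, a2, b1, b2, c]"
    and "{Neg x1, Pos a1, Pos b1} \<in> \<Gamma>" "{Neg x1, Pos a1, Pos c} \<in> \<Gamma>"
    and "{Neg x2, Pos a2, Pos b2} \<in> \<Gamma>" "{Neg x2, Pos a2, Pos c} \<in> \<Gamma>"
    and "{Neg a1, Neg a2} \<in> \<Gamma>" "{Neg b1, Neg b2} \<in> \<Gamma>" "{Neg a1, Neg c} \<in> \<Gamma>" "{Neg a2, Neg c} \<in> \<Gamma>"
  shows "derives res1 \<Gamma> 8 {{Neg x1, Neg x2}}"
proof -
  note [simp] = is_clause_insert
  let ?D = "\<lambda>m A. derives res1 \<Gamma> m A"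
  let ?C1 = "{Neg x1, Pos a1, Neg b2}" and ?C2 = "{Neg x1, Pos a1, Neg x2, Pos a2}"
    and ?C3 = "{Neg x2, Pos a2, Neg a1}" and ?C4 = "{Neg x2, Neg a1}"
    and ?C5 = "{Neg x1, Pos a1, Neg a2}" and ?C6 = "{Neg x1, Neg a2}"
    and ?C7 = "{Neg x1, Neg x2, Pos a2}" and ?C8 = "{Neg x1, Neg x2}"
  have 0: "?D 0 {}" by (simp add: derives_subset)
  have 1: "?D (Suc 0) {?C1}"
    by (rule derives_res1[OF 0, of "{Neg x1, Pos a1, Pos b1}" "{Neg b1, Neg b2}" "Pos b1"])
      (use assms in auto)
  have 2: "?D (Suc (Suc 0)) {?C2, ?C1}"
    by (rule derives_res1[OF 1, of "{Neg x2, Pos a2, Pos b2}" ?C1 "Pos b2"]) (use assms in auto)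
  have 3: "?D (Suc (Suc (Suc 0))) {?C3, ?C2, ?C1}"
    by (rule derives_res1[OF 2, of "{Neg x2, Pos a2, Pos c}" "{Neg a1, Neg c}" "Pos c"])
      (use assms in auto)
  have 4: "?D (Suc (Suc (Suc (Suc 0)))) {?C4, ?C3, ?C2, ?C1}"
    by (rule derives_res1[OF 3, of ?C3 "{Neg a1, Neg a2}" "Pos a2"]) (use assms in auto)
  have 5: "?D (Suc (Suc (Suc (Suc (Suc 0))))) {?C5, ?C4, ?C3, ?C2, ?C1}"
    by (rule derives_res1[OF 4, of "{Neg x1, Pos a1, Pos c}" "{Neg a2, Neg c}" "Pos c"])
      (use assms in auto)
  have 6: "?D (Suc (Suc (Suc (Suc (Suc (Suc 0)))))) {?C6, ?C5, ?C4, ?C3, ?C2, ?C1}"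
    by (rule derives_res1[OF 5, of ?C5 "{Neg a1, Neg a2}" "Pos a1"]) (use assms in auto)
  have 7: "?D (Suc (Suc (Suc (Suc (Suc (Suc (Suc 0))))))) {?C7, ?C6, ?C5, ?C4, ?C3, ?C2, ?C1}"
    by (rule derives_res1[OF 6, of ?C2 ?C4 "Pos a1"]) (use assms in auto)
  have "?D (Suc (Suc (Suc (Suc (Suc (Suc (Suc (Suc 0)))))))) {?C8, ?C7, ?C6, ?C5, ?C4, ?C3, ?C2, ?C1}"
    by (rule derives_res1[OF 7, of ?C7 ?C6 "Pos a2"]) (use assms in auto)
  then show ?thesis by (rule derives_weaken) auto
qed

lemma derives_hole_clause:
  assumes i: "i \<le> k" "i' \<le> k" "i \<noteq> i'" and j: "j < k"
  shows "derives res1 (php (Suc k) \<union> ext k) 8 {hole_clause k i i' j}"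
proof -
  let ?v = "pvar (Suc k)"
  have hole: "{Neg (?v l h), Neg (?v l' h)} \<in> php (Suc k) \<union> ext k"
    if "l \<le> Suc k" "l' \<le> Suc k" "l \<noteq> l'" "h < Suc k" for l l' h
    using hole_clause_in_php[OF that] unfolding hole_clause_def by blast
  have def: "C \<in> php (Suc k) \<union> ext k" if "C \<in> def_clauses k l j" "l \<le> k" for C l
    using that j def_clausesI by blast
  show ?thesis unfolding hole_clause_def
  proof (rule derives_merged_hole_clause)
    show "distinct [pvar k i j, pvar k i' j, ?v i j, ?v i' j, ?v i k, ?v i' k, ?v (Suc k) j]"
      using i j by auto
    show "{Neg (pvar k i j), Pos (?v i j), Pos (?v i k)} \<in> php (Suc k) \<union> ext k"
      "{Neg (pvar k i j), Pos (?v i j), Pos (?v (Suc k) j)} \<in> php (Suc k) \<union> ext k"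
      by (rule def[of _ i]; use i in \<open>simp add: def_clauses_def\<close>)+
    show "{Neg (pvar k i' j), Pos (?v i' j), Pos (?v i' k)} \<in> php (Suc k) \<union> ext k"
      "{Neg (pvar k i' j), Pos (?v i' j), Pos (?v (Suc k) j)} \<in> php (Suc k) \<union> ext k"
      by (rule def[of _ i']; use i in \<open>simp add: def_clauses_def\<close>)+
  qed (rule hole; use i j in simp)+
qed

lemma card_php: "card (php k) \<le> 2 * (k + 1) ^ 3"
proof -
  have "{hole_clause k i i' j | i i' j. i \<le> k \<and> i' \<le> k \<and> i \<noteq> i' \<and> j < k}
    \<subseteq> (\<lambda>(i, i', j). hole_clause k i i' j) ` ({..k} \<times> {..k} \<times> {..<k})" (is "?H \<subseteq> _ ` ?I") by force
  then have "card ?H \<le> card ((\<lambda>(i, i', j). hole_clause k i i' j) ` ?I)" by (intro card_mono) auto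
  also have "\<dots> \<le> card ?I" by (intro card_image_le) auto
  also have "\<dots> \<le> (k + 1) ^ 3"
    by (simp add: card_cartesian_product power3_eq_cube algebra_simps)
  finally have "card ?H \<le> (k + 1) ^ 3" .
  moreover have "card (pigeon_clause k ` {..k}) \<le> k + 1"
    using card_image_le[of "{..k}" "pigeon_clause k"] by simp
  moreover have "k + 1 \<le> (k + 1) ^ 3" by (simp add: power3_eq_cube)
  ultimately show ?thesis unfolding php_def
    using card_Un_le[of "pigeon_clause k ` {..k}" ?H] by linarith
qed

lemma derives_php_level: "derives res1 (php (Suc k) \<union> ext k) (20 * (k + 1) ^ 4) (php k)"
proof -
  have "derives res1 (php (Suc k) \<union> ext k) (2 * k + 8) {C}" if "C \<in> php k" for C
  proof -
    from that consider i where "i \<le> k" "C = pigeon_clause k i"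
      | i i' j where "i \<le> k" "i' \<le> k" "i \<noteq> i'" "j < k" "C = hole_clause k i i' j"
      unfolding php_def by blast
    then show ?thesis
    proof cases
      case 1
      then show ?thesis using derives_weaken[OF derives_pigeon_clause] by simp
    next
      case 2
      then show ?thesis using derives_weaken[OF derives_hole_clause] by simp
    qed
  qed
  then have "derives res1 (php (Suc k) \<union> ext k) (card (php k) * (2 * k + 8)) (php k)"
    using is_cnf_php unfolding is_cnf_def by (intro derives_finite[OF mono_res1]) auto
  \<comment> \<open>The constant 20 is 2 from \<open>card_php\<close> times 10 from
    \<open>2 * k + 8 \<le> 10 * (k + 1)\<close>.\<close>
  moreover have "card (php k) * (2 * k + 8) \<le> (2 * (k + 1) ^ 3) * (10 * (k + 1))"
    by (intro mult_le_mono card_php) simp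
  moreover have "\<dots> = 20 * (k + 1) ^ 4" by (simp only: power3_eq_cube power4_eq_xxxx ac_simps)
  ultimately show ?thesis using derives_weaken[OF _ order.refl] by metis
qed

lemma derives_php:
  "l \<le> N \<Longrightarrow> derives res1 (php N \<union> exts l N) ((N - l) * (20 * (N + 1) ^ 4)) (php l)"
proof (induction l rule: inc_induct)
  case base
  then show ?case by (simp add: derives_subset)
next
  case (step l)
  let ?B = "20 * (N + 1) ^ 4"
  have eq: "php N \<union> exts l N = php N \<union> exts (Suc l) N \<union> ext l" using exts_step step.hyps by auto
  have 1: "derives res1 (php N \<union> exts l N) ((N - Suc l) * ?B) (php (Suc l))"
    by (rule derives_mono[OF mono_res1 step.IH]) (auto simp: eq)
  have "20 * (l + 1) ^ 4 \<le> ?B" using step.hyps by (intro mult_le_mono2 power_mono) auto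
  then have 2: "derives res1 (php N \<union> exts l N \<union> php (Suc l)) ?B (php l)"
    by (rule derives_mono[OF mono_res1 derives_php_level, rotated]) (auto simp: eq)
  have "(N - Suc l) * ?B + ?B = (N - l) * ?B"
    using step.hyps by (metis Suc_diff_Suc add.commute mult_Suc)
  then show ?case using derives_trans[OF mono_res1 1 2] derives_weaken by (metis order_refl sup_ge2)
qed

lemma derives_empty_php: "derives res1 (php N \<union> exts 0 N) (20 * (N + 1) ^ 5) {{}}"
proof -
  \<comment> \<open>On level 0 there is one pigeon and no hole, so its pigeon clause is
    empty.\<close>
  have "{} \<in> php 0" unfolding php_def pigeon_clause_def by simp
  moreover have "N * (20 * (N + 1) ^ 4) \<le> 20 * (N + 1) ^ 5"
  proof -
    have "x ^ 5 = x * x ^ 4" for x :: nat by (simp add: eval_nat_numeral)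
    then have "20 * (N + 1) ^ 5 = (N + 1) * (20 * (N + 1) ^ 4)" by (simp only: ac_simps)
    then show ?thesis by simp
  qed
  ultimately show ?thesis using derives_weaken[OF derives_php[of 0 N]] by auto
qed

text \<open>Halving identifies a variable with its twin. Variables of other levels go to the dummy
  hole \<open>N\<close>, which makes them false in every critical assignment.\<close>

definition cell :: "nat \<Rightarrow> nat \<Rightarrow> nat \<times> nat" where
  "cell N v = (let (k, p) = prod_decode (v div 2) in if k = N then prod_decode p else (0, N))"

lemma cell_pvar [simp]:
  "cell N (pvar k i j) = (if k = N then (i, j) else (0, N))"
  "cell N (Suc (pvar k i j)) = (if k = N then (i, j) else (0, N))"
  unfolding cell_def pvar_def by simp_all

lemma php_falsified_by_critical:
  assumes "C \<in> php N"
  shows "\<exists>i. \<forall>\<sigma>. bij_betw \<sigma> {..N} {..N} \<longrightarrow> falsifies (crit_val N (cell N) \<sigma>) C \<longrightarrow> \<sigma> i = N \<and> i \<le> N"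
proof -
  from assms consider i where "i \<le> N" "C = pigeon_clause N i"
    | i i' j where "i \<le> N" "i' \<le> N" "i \<noteq> i'" "j < N" "C = hole_clause N i i' j"
    unfolding php_def by blast
  then show ?thesis
  proof cases
    case 1
    have "\<sigma> i = N" if "bij_betw \<sigma> {..N} {..N}" "falsifies (crit_val N (cell N) \<sigma>) C" for \<sigma>
    proof (rule ccontr)
      assume "\<sigma> i \<noteq> N"
      moreover have "\<sigma> i \<le> N" using that(1) 1(1) by (auto dest: bij_betwE)
      ultimately have "Pos (pvar N i (\<sigma> i)) \<in> C" "crit_val N (cell N) \<sigma> (pvar N i (\<sigma> i))"
        using 1 unfolding pigeon_clause_def crit_val_def by auto
      then show False using that(2) unfolding falsifies_def by fastforce
    qed
    then show ?thesis using 1(1) by blast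
  next
    case 2
    have False if "bij_betw \<sigma> {..N} {..N}" "falsifies (crit_val N (cell N) \<sigma>) C" for \<sigma>
    proof -
      have "\<sigma> i = j" "\<sigma> i' = j"
        using that(2) 2 unfolding hole_clause_def falsifies_def crit_val_def by auto
      then show False using that(1) 2(1-3) unfolding bij_betw_def by (auto dest: inj_onD)
    qed
    then show ?thesis by blast
  qed
qed

section \<open>The two families of formulas, with their short proofs and lower bounds\<close>

definition php_weakened :: "nat \<Rightarrow> nat cnf" where
  "php_weakened N = weakenings (box N) (php N)"

definition php_twins :: "nat \<Rightarrow> nat cnf" where
  "php_twins N = php N \<union> (\<Union>v\<in>box N. {{Neg v, Pos (Suc v)}, {Pos v, Neg (Suc v)}})"

lemma even_box: "v \<in> box N \<Longrightarrow> even v"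
  unfolding box_def pvar_def by auto

lemma is_cnf_php_weakened: "is_cnf (php_weakened N)"
  unfolding php_weakened_def by (intro is_cnf_weakenings is_cnf_php finite_box)

lemma is_cnf_php_twins: "is_cnf (php_twins N)"
  unfolding php_twins_def is_cnf_Un
  using finite_box is_cnf_php by (auto simp: is_cnf_def is_clause_insert)

lemma cnf_vars_php_weakened: "cnf_vars (php_weakened N) = box N"
  unfolding php_weakened_def
proof (rule cnf_vars_weakenings[OF cnf_vars_php])
  show "pigeon_clause N 0 \<in> php N" unfolding php_def by auto
qed (auto simp: pigeon_clause_def)

lemma cnf_vars_php_twins: "cnf_vars (php_twins N) = box N \<union> Suc ` box N"
  using cnf_vars_php[of N] unfolding php_twins_def cnf_vars_Un
  by (auto simp: cnf_vars_def lits_vars_def)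

lemma php_weakened_lower_bound:
  assumes "steps res_rule (php_weakened (2 * n)) k \<Delta>" and "{} \<in> \<Delta>" and "n \<ge> 2"
  shows "18 ^ n \<le> k * 17 ^ n"
proof (rule resolution_lower_bound[OF assms])
  fix C assume "C \<in> php_weakened (2 * n)"
  then obtain D where "D \<in> php (2 * n)" "D \<subseteq> C" unfolding php_weakened_def weakenings_def by blast
  then show "\<exists>i. \<forall>\<sigma>. bij_betw \<sigma> {..2 * n} {..2 * n} \<longrightarrow>
      falsifies (crit_val (2 * n) (cell (2 * n)) \<sigma>) C \<longrightarrow> \<sigma> i = 2 * n \<and> i \<le> 2 * n"
    using php_falsified_by_critical falsifies_subset by meson
qed

lemma php_twins_lower_bound:
  assumes "steps res_rule (php_twins (2 * n)) k \<Delta>" and "{} \<in> \<Delta>" and "n \<ge> 2"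
  shows "18 ^ n \<le> k * 17 ^ n"
proof (rule resolution_lower_bound[OF assms])
  fix C assume "C \<in> php_twins (2 * n)"
  then consider "C \<in> php (2 * n)"
    | v where "v \<in> box (2 * n)" "C = {Neg v, Pos (Suc v)} \<or> C = {Pos v, Neg (Suc v)}"
    unfolding php_twins_def by blast
  then show "\<exists>i. \<forall>\<sigma>. bij_betw \<sigma> {..2 * n} {..2 * n} \<longrightarrow>
      falsifies (crit_val (2 * n) (cell (2 * n)) \<sigma>) C \<longrightarrow> \<sigma> i = 2 * n \<and> i \<le> 2 * n"
  proof cases
    case 1
    then show ?thesis by (rule php_falsified_by_critical)
  next
    case 2
    then have "cell (2 * n) (Suc v) = cell (2 * n) v" unfolding box_def by auto
    then have "\<not> falsifies (crit_val (2 * n) (cell (2 * n)) \<sigma>) C" for \<sigma>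
      using 2(2) unfolding falsifies_def crit_val_def by auto
    then show ?thesis by blast
  qed
qed

lemma rat_minus_proof_php_weakened:
  "\<exists>\<Pi>. rat_minus_proof (php_weakened N) \<Pi> \<and> length \<Pi> \<le> 1 + 4 * (N + 1) ^ 3 + 20 * (N + 1) ^ 5"
proof -
  let ?\<Gamma> = "php_weakened N"
  obtain k where k: "k \<le> card (exts 0 N)" "steps rat_rule ?\<Gamma> k (?\<Gamma> \<union> exts 0 N)"
    using steps_rat_exts[of 0 N] unfolding php_weakened_def by auto
  have "php N \<subseteq> ?\<Gamma>" unfolding php_weakened_def weakenings_def by blast
  then have "derives res1 (?\<Gamma> \<union> exts 0 N) (20 * (N + 1) ^ 5) {{}}"
    by (intro derives_mono[OF mono_res1 derives_empty_php]) auto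
  then obtain l \<Delta> where l: "l \<le> 20 * (N + 1) ^ 5" "steps res1 (?\<Gamma> \<union> exts 0 N) l \<Delta>" "{} \<in> \<Delta>"
    unfolding derives_def by auto
  have "steps rat_rule (?\<Gamma> \<union> exts 0 N) l \<Delta>"
    by (rule steps_rule_mono[OF l(2)]) (simp add: rat_rule_def res1_res_rule)
  then have "steps rat_rule ?\<Gamma> (k + l) \<Delta>" using steps_trans k(2) by blast
  from refutation_of_steps[OF this is_cnf_php_weakened l(3)] obtain \<Pi>
    where \<Pi>: "refutation_by rat_rule ?\<Gamma> \<Pi>" "length \<Pi> = Suc (k + l)" "\<forall>\<Theta>\<in>set \<Pi>. \<Theta> \<subseteq> \<Delta>" by blast
  \<comment> \<open>All CNFs of the proof are subsets of \<open>\<Delta>\<close>, and resolution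
    without weakening adds no variables to those of the extension clauses and
    \<open>?\<Gamma>\<close>.\<close>
  have "cnf_vars \<Delta> \<subseteq> cnf_vars ?\<Gamma>"
    using steps_res1_vars[OF l(2)] cnf_vars_exts[of 0 N] by (auto simp: cnf_vars_Un cnf_vars_php_weakened)
  then have "rat_minus_proof ?\<Gamma> \<Pi>"
    using \<Pi>(1,3) cnf_vars_mono unfolding rat_minus_proof_def rat_proof_def by blast
  moreover have "length \<Pi> \<le> 1 + 4 * (N + 1) ^ 3 + 20 * (N + 1) ^ 5"
    using \<Pi>(2) k(1) l(1) card_exts[of N] by linarith
  ultimately show ?thesis by blast
qed

lemma ger_minus_size_php_weakened:
  assumes "ger_minus_proof (php_weakened (2 * n)) P" and "n \<ge> 2"
  shows "18 ^ n \<le> ger_size P * 17 ^ n"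
proof -
  let ?\<Gamma> = "php_weakened (2 * n)"
  obtain \<Lambda> \<Pi> where P: "P = (\<Lambda>, \<Pi>)" by (cases P)
  have ext: "blocked_extension ?\<Gamma> \<Lambda>" "cnf_vars \<Lambda> \<subseteq> cnf_vars ?\<Gamma>"
    and \<Pi>: "refutation_by res_rule (?\<Gamma> \<union> \<Lambda>) \<Pi>"
    using assms(1) unfolding P ger_minus_proof_def ger_proof_def resolution_proof_def by auto
  have "\<Lambda> \<subseteq> ?\<Gamma>"
  proof (rule blocked_extension_trivial[OF _ ext])
    show "finite ?\<Gamma>" using is_cnf_php_weakened unfolding is_cnf_def by blast
    show "\<not> blocked C ?\<Gamma>" if "lits_vars C \<subseteq> cnf_vars ?\<Gamma>" for C
      using that not_blocked_weakenings[OF php_unsat] unfolding cnf_vars_php_weakened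
      unfolding php_weakened_def by blast
  qed
  then have "refutation_by res_rule ?\<Gamma> \<Pi>" using \<Pi> by (simp add: Un_absorb2)
  then obtain k where "length \<Pi> = Suc k" "steps res_rule ?\<Gamma> k (last \<Pi>)"
    using steps_of_refutation by blast
  moreover have "{} \<in> last \<Pi>" using \<Pi> unfolding refutation_by_def by simp
  ultimately have "18 ^ n \<le> k * 17 ^ n" "k \<le> ger_size P"
    using php_weakened_lower_bound assms(2) by (auto simp: P ger_size_def)
  then show ?thesis by (meson le_trans mult_le_mono1)
qed

text \<open>The pivot is the twin \<open>Suc v\<close>: being odd, it occurs only in its own two
  equivalence clauses, and these also clash on \<open>v\<close>.\<close>

lemma twin_clause_blocked:
  assumes "cnf_vars \<Delta> \<subseteq> box N" and "v \<in> box N"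
    and "C = {Neg v, Pos (Suc v)} \<or> C = {Pos v, Neg (Suc v)}"
  shows "blocked C (\<Delta> \<union> (\<Union>v\<in>box N. {{Neg v, Pos (Suc v)}, {Pos v, Neg (Suc v)}}))"
proof -
  obtain p where Cp: "C = {Neg v, Pos (Suc v)} \<and> p = Pos (Suc v) \<or> C = {Pos v, Neg (Suc v)} \<and> p = Neg (Suc v)"
    using assms(3) by blast
  then have p: "p \<in> C" "var_of p = Suc v" by auto
  have "blocked_for p C (\<Delta> \<union> (\<Union>v\<in>box N. {{Neg v, Pos (Suc v)}, {Pos v, Neg (Suc v)}}))"
  proof (rule blocked_forI[OF _ p(1)])
    show "is_clause C" using assms(3) by (auto simp: is_clause_insert)
    fix D assume D: "D \<in> \<Delta> \<union> (\<Union>v\<in>box N. {{Neg v, Pos (Suc v)}, {Pos v, Neg (Suc v)}})" "compl p \<in> D"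
    then have v: "Suc v \<in> lits_vars D" using p(2) by (metis var_in_lits_vars_iff)
    have "Suc v \<notin> box N" using even_box[OF assms(2)] even_box[of "Suc v" N] by auto
    then have "D \<notin> \<Delta>" using v assms(1) unfolding cnf_vars_def by blast
    then obtain w where w: "w \<in> box N" "D = {Neg w, Pos (Suc w)} \<or> D = {Pos w, Neg (Suc w)}"
      using D(1) by blast
    then have "w = v" using v \<open>Suc v \<notin> box N\<close> by (auto simp: lits_vars_def)
    then have "D = {Neg v, Pos (Suc v)} \<or> D = {Pos v, Neg (Suc v)}" using w(2) by simp
    then show "\<exists>r\<in>C. r \<noteq> p \<and> compl r \<in> D" using Cp D(2) by (elim disjE) simp_all
  qed
  then show ?thesis using p(1) unfolding blocked_def by blast
qed

lemma remove_twins: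
  assumes "cnf_vars \<Delta> \<subseteq> box N"
  shows "remove_blocked\<^sup>*\<^sup>* (\<Delta> \<union> (\<Union>v\<in>box N. {{Neg v, Pos (Suc v)}, {Pos v, Neg (Suc v)}})) \<Delta>"
proof (rule remove_blocked_Un)
  show "finite (\<Union>v\<in>box N. {{Neg v, Pos (Suc v)}, {Pos v, Neg (Suc v)}})" using finite_box by simp
qed (use twin_clause_blocked[OF assms] in auto)

text \<open>Both kernels reduce to that of \<open>php N\<close>. The twin clauses are removed before
  the extension clauses, which would otherwise have to clash with the twin clauses of their
  pivots.\<close>

lemma blocked_extension_exts: "blocked_extension (php_twins N) (exts 0 N)"
proof -
  let ?T = "\<Union>v\<in>box N. {{Neg v, Pos (Suc v)}, {Pos v, Neg (Suc v)}}"
  have fin: "finite (php_twins N)" "finite (exts 0 N)"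
    using is_cnf_php_twins is_cnf_exts unfolding is_cnf_def by blast+
  have "remove_blocked\<^sup>*\<^sup>* (php N \<union> exts 0 N \<union> ?T) (php N \<union> exts 0 N)"
    using cnf_vars_php cnf_vars_exts by (intro remove_twins) (simp add: cnf_vars_Un)
  also have "remove_blocked\<^sup>*\<^sup>* \<dots> (php N)" by (rule remove_exts) simp
  finally have "remove_blocked\<^sup>*\<^sup>* (php_twins N \<union> exts 0 N) (php N)"
    unfolding php_twins_def by (simp add: Un_ac)
  then have "kernel (php_twins N \<union> exts 0 N) = kernel (php N)"
    by (intro kernel_eq_of_remove_blocked) (use fin in auto)
  moreover have "kernel (php_twins N) = kernel (php N)"
    using remove_twins[OF cnf_vars_php] fin(1) unfolding php_twins_def
    by (rule_tac kernel_eq_of_remove_blocked) auto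
  ultimately show ?thesis unfolding blocked_extension_def using is_cnf_exts by simp
qed

lemma ger_minus_proof_php_twins:
  "\<exists>P. ger_minus_proof (php_twins N) P \<and> ger_size P \<le> 1 + 4 * (N + 1) ^ 3 + 20 * (N + 1) ^ 5"
proof -
  let ?\<Gamma> = "php_twins N \<union> exts 0 N"
  have "derives res1 ?\<Gamma> (20 * (N + 1) ^ 5) {{}}"
    by (rule derives_mono[OF mono_res1 derives_empty_php]) (auto simp: php_twins_def)
  then obtain l \<Delta> where l: "l \<le> 20 * (N + 1) ^ 5" "steps res1 ?\<Gamma> l \<Delta>" "{} \<in> \<Delta>"
    unfolding derives_def by auto
  have "steps res_rule ?\<Gamma> l \<Delta>" by (rule steps_rule_mono[OF l(2)]) (rule res1_res_rule)
  moreover have "is_cnf ?\<Gamma>" using is_cnf_php_twins is_cnf_exts by (simp add: is_cnf_Un)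
  ultimately obtain \<Pi> where \<Pi>: "refutation_by res_rule ?\<Gamma> \<Pi>" "length \<Pi> = Suc l"
    using refutation_of_steps l(3) by blast
  have "ger_minus_proof (php_twins N) (exts 0 N, \<Pi>)"
    using \<Pi>(1) is_cnf_php_twins blocked_extension_exts cnf_vars_exts[of 0 N]
    unfolding ger_minus_proof_def ger_proof_def resolution_proof_def
    by (auto simp: cnf_vars_php_twins)
  moreover have "ger_size (exts 0 N, \<Pi>) \<le> 1 + 4 * (N + 1) ^ 3 + 20 * (N + 1) ^ 5"
    using \<Pi>(2) l(1) card_exts[of N] by (simp add: ger_size_def)
  ultimately show ?thesis by blast
qed

lemma twin_literal:
  assumes "var_of p \<in> box N \<union> Suc ` box N"
  shows "\<exists>b. var_of b \<noteq> var_of p \<and> {compl p, b} \<in> php_twins N \<and> {compl b, p} \<in> php_twins N"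
proof -
  from assms obtain v where v: "v \<in> box N" "var_of p = v \<or> var_of p = Suc v" by blast
  then have T: "{Neg v, Pos (Suc v)} \<in> php_twins N" "{Pos v, Neg (Suc v)} \<in> php_twins N"
    unfolding php_twins_def by blast+
  from v(2) consider "p = Pos v" | "p = Neg v" | "p = Pos (Suc v)" | "p = Neg (Suc v)"
    by (cases p) auto
  then show ?thesis
  proof cases
    case 1
    then show ?thesis using T by (intro exI[of _ "Pos (Suc v)"]) (auto simp: insert_commute)
  next
    case 2
    then show ?thesis using T by (intro exI[of _ "Neg (Suc v)"]) (auto simp: insert_commute)
  next
    case 3
    then show ?thesis using T by (intro exI[of _ "Pos v"]) (auto simp: insert_commute)
  next
    case 4
    then show ?thesis using T by (intro exI[of _ "Neg v"]) (auto simp: insert_commute)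
  qed
qed

lemma rat_minus_size_php_twins:
  assumes "rat_minus_proof (php_twins (2 * n)) \<Pi>" and "n \<ge> 2"
  shows "18 ^ n \<le> length \<Pi> * (2 * (2 * n + 1) ^ 3 + 2) * 17 ^ n"
proof -
  let ?\<Gamma> = "php_twins (2 * n)" and ?V = "box (2 * n) \<union> Suc ` box (2 * n)"
  have \<Pi>: "refutation_by rat_rule ?\<Gamma> \<Pi>" "\<forall>\<Delta>\<in>set \<Pi>. cnf_vars \<Delta> \<subseteq> ?V"
    using assms(1) unfolding rat_minus_proof_def rat_proof_def cnf_vars_php_twins by auto
  then have ne: "\<Pi> \<noteq> []" "{} \<in> last \<Pi>" unfolding refutation_by_def by auto
  obtain k where k: "length \<Pi> = Suc k" "steps rat_rule ?\<Gamma> k (last \<Pi>)"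
    using steps_of_refutation[OF \<Pi>(1)] by blast
  have "derives res_rule ?\<Gamma> (k * (card ?V + 2)) (last \<Pi>)"
    using \<Pi>(2) ne(1) finite_box by (intro derives_rat_steps_of_twins[OF k(2) is_cnf_php_twins _ _ twin_literal]) auto
  then obtain l \<Delta> where l: "l \<le> k * (card ?V + 2)" "steps res_rule ?\<Gamma> l \<Delta>" "last \<Pi> \<subseteq> \<Delta>"
    unfolding derives_def by blast
  have "card ?V \<le> card (box (2 * n)) + card (box (2 * n))"
    using card_Un_le[of "box (2 * n)" "Suc ` box (2 * n)"] card_image_le[OF finite_box, of Suc "2 * n"]
    by linarith
  then have "card ?V + 2 \<le> 2 * (2 * n + 1) ^ 3 + 2" using card_box[of "2 * n"] by linarith
  then have "k * (card ?V + 2) \<le> length \<Pi> * (2 * (2 * n + 1) ^ 3 + 2)"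
    using k(1) by (intro mult_le_mono) auto
  then have "l \<le> length \<Pi> * (2 * (2 * n + 1) ^ 3 + 2)" using l(1) by linarith
  moreover have "18 ^ n \<le> l * 17 ^ n" using php_twins_lower_bound[OF l(2)] ne(2) l(3) assms(2) by blast
  ultimately show ?thesis by (meson le_trans mult_le_mono1)
qed

section \<open>Growth rates\<close>

text \<open>\<open>6075 = 25 * 3 ^ 5\<close>, with \<open>25 = 1 + 4 + 20\<close> and
  \<open>2 * n + 1 \<le> 3 * n\<close>. It is also the exponent because
  \<open>admits_poly_size\<close> uses one constant for both.\<close>

lemma short_proof_size:
  fixes n :: nat
  assumes "n \<ge> 1"
  shows "1 + 4 * (2 * n + 1) ^ 3 + 20 * (2 * n + 1) ^ 5 \<le> 6075 * n ^ 6075"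
proof -
  have "1 + 4 * (2 * n + 1) ^ 3 + 20 * (2 * n + 1) ^ 5 \<le> 25 * (2 * n + 1) ^ 5"
    using power_increasing[of 3 5 "2 * n + 1"] one_le_power[of "2 * n + 1" 5] by linarith
  also have "\<dots> \<le> 25 * (3 * n) ^ 5" using assms by (intro mult_le_mono2 power_mono) auto
  also have "\<dots> = 6075 * n ^ 5" by (simp add: power_mult_distrib)
  also have "\<dots> \<le> 6075 * n ^ 6075" using assms by (intro mult_le_mono2 power_increasing) auto
  finally show ?thesis .
qed

lemma admits_poly_sizeI:
  assumes "\<And>N. \<exists>P. is_proof (\<Gamma> N) P \<and> psize P \<le> 1 + 4 * (N + 1) ^ 3 + 20 * (N + 1) ^ 5"
  shows "admits_poly_size is_proof psize (\<lambda>n. \<Gamma> (2 * n))"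
  unfolding admits_poly_size_def
proof (intro exI[of _ 6075] allI impI)
  fix n :: nat assume n: "n \<ge> 1"
  obtain P where "is_proof (\<Gamma> (2 * n)) P"
    "psize P \<le> 1 + 4 * (2 * n + 1) ^ 3 + 20 * (2 * n + 1) ^ 5" using assms by blast
  then show "\<exists>P. is_proof (\<Gamma> (2 * n)) P \<and> psize P \<le> 6075 * n ^ 6075"
    using short_proof_size[OF n] by (intro exI[of _ P]) linarith
qed

text \<open>The polynomial factor is the cost of simulating a RAT line; the GER bound holds without
  it and so in particular with it.\<close>

lemma requires_exp_sizeI:
  assumes "\<And>n P. n \<ge> 2 \<Longrightarrow> is_proof (\<Gamma> n) P \<Longrightarrow> 18 ^ n \<le> psize P * (2 * (2 * n + 1) ^ 3 + 2) * 17 ^ n"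
  shows "requires_exp_size is_proof psize \<Gamma>"
proof -
  \<comment> \<open>Then \<open>(17/18)^n\<close> is the square of \<open>x ^ (3 * n)\<close>. One
    factor absorbs \<open>125 * n ^ 3\<close>, since eventually \<open>n * x ^ n < 1 / 5\<close>;
    the other one yields the exponential bound.\<close>
  define x :: real where "x = root 6 (17 / 18)"
  have x6: "x ^ 6 = 17 / 18" unfolding x_def by (simp add: real_root_pow_pos2)
  have x: "0 < x" "x < 1" unfolding x_def using real_root_lt_1_iff[of 6 "17 / 18"] by simp_all
  define \<epsilon> where "\<epsilon> = log 2 (1 / x ^ 3)"
  have "1 < 1 / x ^ 3" using x power_Suc_less_one[of x 2] by (simp add: numeral_3_eq_3)
  then have "\<epsilon> > 0" unfolding \<epsilon>_def using x by (subst zero_less_log_cancel_iff) auto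
  have powr: "2 powr (\<epsilon> * real n) = 1 / x ^ (3 * n)" for n
  proof -
    have "2 powr (\<epsilon> * real n) = (2 powr \<epsilon>) ^ n" by (simp add: powr_powr[symmetric] powr_realpow)
    also have "2 powr \<epsilon> = 1 / x ^ 3" unfolding \<epsilon>_def using x by simp
    finally show ?thesis by (simp add: power_divide power_mult)
  qed
  have "(\<lambda>n. real n * x ^ n) \<longlonglongrightarrow> 0" using powser_times_n_limit_0[of x] x by simp
  then have "\<forall>\<^sub>F n in sequentially. real n * x ^ n < 1 / 5" by (rule order_tendstoD) simp
  then have "\<forall>\<^sub>F n in sequentially. \<forall>P. is_proof (\<Gamma> n) P \<longrightarrow> 2 powr (\<epsilon> * real n) \<le> real (psize P)"
    using eventually_ge_at_top[of 2]
  proof eventually_elim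
    case (elim n)
    show ?case
    proof (intro allI impI)
      fix P assume "is_proof (\<Gamma> n) P"
      then have "18 ^ n \<le> psize P * (2 * (2 * n + 1) ^ 3 + 2) * 17 ^ n" using assms elim by blast
      also have "\<dots> \<le> psize P * (125 * n ^ 3) * 17 ^ n"
      proof -
        have "(2 * n + 1) ^ 3 \<le> (3 * n) ^ 3" using elim by (intro power_mono) auto
        moreover have "1 \<le> n ^ 3" using elim by simp
        ultimately have "2 * (2 * n + 1) ^ 3 + 2 \<le> 125 * n ^ 3" by (simp add: power_mult_distrib)
        then show ?thesis by (intro mult_le_mono) auto
      qed
      finally have "real (18 ^ n) \<le> real (psize P * (125 * n ^ 3) * 17 ^ n)" by (rule of_nat_mono)
      then have le: "18 ^ n \<le> real (psize P) * (125 * real n ^ 3) * 17 ^ n" by simp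
      have "1 \<le> real (psize P) * (125 * real n ^ 3) * (17 / 18) ^ n"
        using divide_right_mono[OF le, of "18 ^ n"] by (simp add: power_divide)
      also have "(17 / 18) ^ n = x ^ (3 * n) * x ^ (3 * n)"
        by (simp add: x6[symmetric] power_mult[symmetric] power_add[symmetric])
      finally have "1 \<le> real (psize P) * (125 * (real n ^ 3 * x ^ (3 * n))) * x ^ (3 * n)"
        by (simp add: algebra_simps)
      also have "\<dots> \<le> real (psize P) * 1 * x ^ (3 * n)"
      proof (intro mult_right_mono mult_left_mono)
        have "(real n * x ^ n) ^ 3 \<le> (1 / 5) ^ 3" using elim x by (intro power_mono) auto
        also have "(real n * x ^ n) ^ 3 = real n ^ 3 * x ^ (3 * n)"
          by (simp add: power_mult_distrib power_mult[symmetric] mult.commute)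
        finally show "125 * (real n ^ 3 * x ^ (3 * n)) \<le> 1" by (simp add: power3_eq_cube)
      qed (use x in auto)
      finally show "2 powr (\<epsilon> * real n) \<le> real (psize P)"
        unfolding powr using x by (simp add: divide_le_eq)
    qed
  qed
  then show ?thesis using \<open>\<epsilon> > 0\<close> unfolding requires_exp_size_def by blast
qed

theorem theorem1p2:
  "(\<exists>\<Gamma> :: nat \<Rightarrow> nat cnf.
      (\<forall>n\<ge>1. is_cnf (\<Gamma> n)) \<and>
      admits_poly_size rat_minus_proof length \<Gamma> \<and>
      requires_exp_size ger_minus_proof ger_size \<Gamma>) \<and>
   (\<exists>\<Delta> :: nat \<Rightarrow> nat cnf.
      (\<forall>n\<ge>1. is_cnf (\<Delta> n)) \<and>
      admits_poly_size ger_minus_proof ger_size \<Delta> \<and>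
      requires_exp_size rat_minus_proof length \<Delta>)"
proof (intro conjI)
  have "admits_poly_size rat_minus_proof length (\<lambda>n. php_weakened (2 * n))"
    using rat_minus_proof_php_weakened by (rule admits_poly_sizeI)
  moreover have "requires_exp_size ger_minus_proof ger_size (\<lambda>n. php_weakened (2 * n))"
  proof (rule requires_exp_sizeI)
    fix n :: nat and P assume "n \<ge> 2" "ger_minus_proof (php_weakened (2 * n)) P"
    then have "18 ^ n \<le> ger_size P * 17 ^ n" by (intro ger_minus_size_php_weakened)
    also have "\<dots> \<le> ger_size P * (2 * (2 * n + 1) ^ 3 + 2) * 17 ^ n" by simp
    finally show "18 ^ n \<le> ger_size P * (2 * (2 * n + 1) ^ 3 + 2) * 17 ^ n" .
  qed
  ultimately show "\<exists>\<Gamma> :: nat \<Rightarrow> nat cnf. (\<forall>n\<ge>1. is_cnf (\<Gamma> n)) \<and>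
      admits_poly_size rat_minus_proof length \<Gamma> \<and> requires_exp_size ger_minus_proof ger_size \<Gamma>"
    using is_cnf_php_weakened by (intro exI[of _ "\<lambda>n. php_weakened (2 * n)"]) simp
  have "admits_poly_size ger_minus_proof ger_size (\<lambda>n. php_twins (2 * n))"
    using ger_minus_proof_php_twins by (rule admits_poly_sizeI)
  moreover have "requires_exp_size rat_minus_proof length (\<lambda>n. php_twins (2 * n))"
    using rat_minus_size_php_twins by (rule requires_exp_sizeI)
  ultimately show "\<exists>\<Delta> :: nat \<Rightarrow> nat cnf. (\<forall>n\<ge>1. is_cnf (\<Delta> n)) \<and>
      admits_poly_size ger_minus_proof ger_size \<Delta> \<and> requires_exp_size rat_minus_proof length \<Delta>"
    using is_cnf_php_twins by (intro exI[of _ "\<lambda>n. php_twins (2 * n)"]) simp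
qed

end
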